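(* Let $n,L\ge 1$ be integers and let $f=(f_1,\dots,f_L):\mathbb{R}^L\to\mathbb{R}^L$ satisfy the following assumptions. (1) $f$ is continuous in $\overline{\mathbb{R}^L_+}$ and locally Lipschitz continuous in $\mathbb{R}^L_+$, and $\sum_{i=1}^L f_i(u)\ge 0$ for all $u\in\mathbb{R}^L_+$. (2) Whenever $\alpha\in\partial\mathbb{R}^L_+$, $\alpha\ne 0$, say $\alpha_{i_1}=\cdots=\alpha_{i_m}=0$ and $\alpha_{i_{m+1}},\dots,\alpha_{i_L}>0$ for some permutation $(i_1,\dots,i_L)$ of $(1,\dots,L)$ and some integer $m$ with $0<m<L$, there exist $\delta_0=\delta_0(\alpha)>0$ and a constant $C(\alpha)\ge 0$ depending only on $\alpha$ such that for all $\beta\in\mathbb{R}^L_+$ with $|\beta-\alpha|<\delta_0$, $$\sum_{j=m+1}^L |f_{i_j}(\beta)|\le C(\alpha)\sum_{j=1}^m f_{i_j}(\beta).$$ Suppose moreover that for every $R>0$ the Dirichlet problem $$-\Delta u_i=f_i(u)\ \text{in } B_R,\qquad u_i>0\ \text{in } B_R,\qquad u_i=0\ \text{on }\partial B_R,\qquad i=1,\dots,L,$$ where $B_R=B_R(0)\subset\mathbb{R}^n$, admits no solution $u=(u_1,\dots,u_L)$. Then the system $$-\Delta u_i=f_i(u)\ \text{in }\mathbb{R}^n,\qquad u_i>0\ \text{in }\mathbb{R}^n,\qquad i=1,\dots,L,$$ admits a radially symmetric solution $u=(u_1,\dots,u_L)$ of class $C^{2,\alpha}(\mathbb{R}^n)$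 with $0<\alpha<1$.
   Context: $\mathbb{R}^L_+=\{u\in\mathbb{R}^L : u_i>0 \text{ for } i=1,\dots,L\}$; $\overline{\mathbb{R}^L_+}$ and $\partial\mathbb{R}^L_+$ denote its closure and boundary in $\mathbb{R}^L$. $B_R(0)$ is the open ball of radius $R$ centered at the origin. Solutions are understood in the classical sense. In the conclusion, the letter $\alpha$ in $C^{2,\alpha}$ is a Hölder exponent, unrelated to the point $\alpha$ in assumption (2). *)

theory Defs
  imports "HOL-Analysis.Analysis"
begin

definition pos_orthant :: "(real ^ 'l) set" where
  "pos_orthant = {u. \<forall>i. u $ i > 0}"

definition locally_lipschitz_on :: "'a::metric_space set \<Rightarrow> ('a \<Rightarrow> 'b::metric_space) \<Rightarrow> bool" where
  "locally_lipschitz_on S g \<longleftrightarrow>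
     (\<forall>x\<in>S. \<exists>e>0. \<exists>K. K-lipschitz_on (cball x e \<inter> S) g)"

definition partial_deriv ::
    "'a::euclidean_space \<Rightarrow> ('a \<Rightarrow> real) \<Rightarrow> 'a \<Rightarrow> real" where
  "partial_deriv b g x = deriv (\<lambda>t. g (x + t *\<^sub>R b)) 0"

definition laplacian :: "('a::euclidean_space \<Rightarrow> real) \<Rightarrow> 'a \<Rightarrow> real" where
  "laplacian g x = (\<Sum>b\<in>Basis. partial_deriv b (partial_deriv b g) x)"

(* The class C^k(S), for open S only. Since deriv is total, existence of
   each partial derivative has to be required separately. *)
primrec Ck_on :: "nat \<Rightarrow> 'a::euclidean_space set \<Rightarrow> ('a \<Rightarrow> real) \<Rightarrow> bool" where
  "Ck_on 0 S g \<longleftrightarrow> continuous_on S g"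
| "Ck_on (Suc k) S g \<longleftrightarrow> continuous_on S g \<and>
     (\<forall>b\<in>Basis. (\<forall>x\<in>S. (\<lambda>t. g (x + t *\<^sub>R b)) field_differentiable at 0) \<and>
                 Ck_on k S (partial_deriv b g))"

definition locally_holder_on ::
    "real \<Rightarrow> 'a::metric_space set \<Rightarrow> ('a \<Rightarrow> real) \<Rightarrow> bool" where
  "locally_holder_on \<gamma> S g \<longleftrightarrow>
     (\<forall>K. compact K \<and> K \<subseteq> S \<longrightarrow>
        (\<exists>C. \<forall>x\<in>K. \<forall>y\<in>K. \<bar>g x - g y\<bar> \<le> C * dist x y powr \<gamma>))"

(* The class C^{2,gamma}(S) for open S, in the usual convention (Gilbarg-Trudinger)
   that the second derivatives are Hoelder continuous on compact subsets of S. *)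
definition C2_holder_on ::
    "real \<Rightarrow> 'a::euclidean_space set \<Rightarrow> ('a \<Rightarrow> real) \<Rightarrow> bool" where
  "C2_holder_on \<gamma> S g \<longleftrightarrow> Ck_on 2 S g \<and>
     (\<forall>b\<in>Basis. \<forall>c\<in>Basis. locally_holder_on \<gamma> S (partial_deriv b (partial_deriv c g)))"

definition positive_classical_solution ::
    "(real ^ 'l \<Rightarrow> real ^ 'l) \<Rightarrow> (real ^ 'n) set \<Rightarrow> (real ^ 'n \<Rightarrow> real ^ 'l) \<Rightarrow> bool" where
  "positive_classical_solution f S u \<longleftrightarrow>
     (\<forall>i. Ck_on 2 S (\<lambda>x. u x $ i) \<and>
          (\<forall>x\<in>S. - laplacian (\<lambda>y. u y $ i) x = f (u x) $ i \<and> u x $ i > 0))"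

(* Classical: twice continuously differentiable inside the ball and
   continuous up to the boundary. *)
definition positive_dirichlet_solution ::
    "(real ^ 'l \<Rightarrow> real ^ 'l) \<Rightarrow> real \<Rightarrow> (real ^ 'n \<Rightarrow> real ^ 'l) \<Rightarrow> bool" where
  "positive_dirichlet_solution f R u \<longleftrightarrow>
     positive_classical_solution f (ball 0 R) u \<and>
     continuous_on (closure (ball 0 R)) u \<and>
     (\<forall>x\<in>frontier (ball 0 R). \<forall>i. u x $ i = 0)"

definition radially_symmetric :: "('a::real_normed_vector \<Rightarrow> 'b) \<Rightarrow> bool" where
  "radially_symmetric u \<longleftrightarrow> (\<forall>x y. norm x = norm y \<longrightarrow> u x = u y)"

end

theory Submission
  imports Defs
begin

text \<open>Shooting. For \<open>a\<close> in the open unit simplex solve the radial equation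
  \<open>u'' + (n - 1) / r * u' = - f(u)\<close>, \<open>u(0) = a\<close>, \<open>u'(0) = 0\<close>, in its integrated form. If no solution stays positive
  for ever, let \<open>\<psi>(a)\<close> be the point where the solution leaves the open orthant, and \<open>\<psi>(a) = a\<close> on
  the boundary of the simplex. The boundary condition on \<open>f\<close> makes \<open>\<psi>\<close> continuous at every \<open>a\<close> with
  \<open>\<psi>(a) \<noteq> 0\<close>. If \<open>\<psi>\<close> never vanished, projecting it radially would retract the simplex onto its
  boundary; hence \<open>\<psi>(a) = 0\<close> for some \<open>a\<close>, and this solution solves the Dirichlet problem on a ball.\<close>

section \<open>Radial means and potentials\<close>

text \<open>The obstacle is that \<open>f\<close> is Lipschitz only inside the orthant. Uniqueness
  and continuous dependence therefore hold on compact intervals strictly before the exit and do not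
  locate the exit point: a trajectory could touch the boundary tangentially while its neighbours
  travel on. The boundary condition excludes this. Near a nonzero boundary point let w be the sum of
  the components that vanish there. The corresponding \<open>f\<close>-components have a nonnegative
  sum, so the flux -r^(n-1) w' cannot decrease, and this sum also dominates the forces on the other
  components. This gives transversal exit from the interior and small displacement from starting
  points near the boundary. The sum of all components cannot increase, which confines every solution
  from the unit simplex to one compact box and makes bounds and Lipschitz constants uniform. A zero
  of \<psi> is a profile whose components vanish simultaneously, which is what the nonexistence
  hypothesis forbids. The remaining case is a profile positive for ever. On compact intervals it
  stays away from the boundary, so \<open>f\<close> along it is Lipschitz in r; this yields every
  exponent below 1.\<close>

definition radial_mean :: "nat \<Rightarrow> (real \<Rightarrow> 'a::euclidean_space) \<Rightarrow> real \<Rightarrow> 'a" where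
  "radial_mean n g s = integral {0..1} (\<lambda>x. x ^ (n - 1) *\<^sub>R g (s * x))"

text \<open>The radial equation reads (r^(n-1) u')' = - r^(n-1) g. Integrating once and substituting
  t = r x gives u'(r) = - r \<open>radial_mean n g r\<close>, and a second integration gives u =
  u(0) - \<open>radial_potential n g\<close>. Rescaling to the unit interval removes the singular
  factor r^(1-n) at the origin.\<close>

definition radial_potential :: "nat \<Rightarrow> (real \<Rightarrow> 'a::euclidean_space) \<Rightarrow> real \<Rightarrow> 'a" where
  "radial_potential n g r = integral {0..r} (\<lambda>s. s *\<^sub>R radial_mean n g s)"

lemma scaled_in_interval:
  fixes s x T :: real
  assumes "s \<in> {0..T}" "x \<in> {0..1}"
  shows "s * x \<in> {0..T}"
  using assms mult_left_le[of x s] by auto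

lemma radial_mean_integrand_continuous:
  fixes g :: "real \<Rightarrow> 'a::euclidean_space"
  assumes "continuous_on {0..T} g" "s \<in> {0..T}"
  shows "continuous_on {0..1} (\<lambda>x. x ^ m *\<^sub>R g (s * x))"
  by (intro continuous_intros continuous_on_compose2[OF assms(1)])
    (use scaled_in_interval[OF assms(2)] in auto)

lemma radial_mean_integrand_integrable:
  fixes g :: "real \<Rightarrow> 'a::euclidean_space"
  assumes "continuous_on {0..T} g" "s \<in> {0..T}"
  shows "(\<lambda>x. x ^ m *\<^sub>R g (s * x)) integrable_on {0..1}"
  using radial_mean_integrand_continuous[OF assms] by (rule integrable_continuous_real)

lemma continuous_on_radial_mean:
  fixes g :: "real \<Rightarrow> 'a::euclidean_space"
  assumes "continuous_on {0..T} g"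
  shows "continuous_on {0..T} (radial_mean n g)"
proof -
  have "continuous_on ({0..T} \<times> cbox 0 1) (\<lambda>(s, x). x ^ (n - 1) *\<^sub>R g (s * x))"
    unfolding case_prod_beta
    by (intro continuous_intros continuous_on_compose2[OF assms])
      (auto simp: scaled_in_interval simp del: atLeastAtMost_iff)
  from integral_continuous_on_param[OF this] show ?thesis
    unfolding radial_mean_def by simp
qed

lemma continuous_on_radial_potential_integrand:
  fixes g :: "real \<Rightarrow> 'a::euclidean_space"
  assumes "continuous_on {0..T} g"
  shows "continuous_on {0..T} (\<lambda>s. s *\<^sub>R radial_mean n g s)"
  by (intro continuous_intros continuous_on_radial_mean assms)

lemma radial_potential_integrand_integrable:
  fixes g :: "real \<Rightarrow> 'a::euclidean_space"
  assumes "continuous_on {0..T} g" "r \<le> T"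
  shows "(\<lambda>s. s *\<^sub>R radial_mean n g s) integrable_on {0..r}"
  by (rule integrable_continuous_real, rule continuous_on_radial_potential_integrand,
      rule continuous_on_subset[OF assms(1)]) (use assms(2) in auto)

lemma radial_potential_has_vector_derivative:
  fixes g :: "real \<Rightarrow> 'a::euclidean_space"
  assumes "continuous_on {0..T} g" "r \<in> {0..T}"
  shows "(radial_potential n g has_vector_derivative r *\<^sub>R radial_mean n g r) (at r within {0..T})"
proof -
  have "((\<lambda>r. integral {0..r} (\<lambda>s. s *\<^sub>R radial_mean n g s)) has_vector_derivative r *\<^sub>R radial_mean n g r)
    (at r within {0..T})"
    by (rule integral_has_vector_derivative) (use assms continuous_on_radial_potential_integrand in auto)
  then show ?thesis by (simp add: radial_potential_def[abs_def])
qed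

lemma continuous_on_radial_potential:
  fixes g :: "real \<Rightarrow> 'a::euclidean_space"
  assumes "continuous_on {0..T} g"
  shows "continuous_on {0..T} (radial_potential n g)"
  unfolding continuous_on_eq_continuous_within
  by (intro ballI has_vector_derivative_continuous[OF radial_potential_has_vector_derivative[OF assms]])

lemma radial_potential_0 [simp]: "radial_potential n g 0 = 0"
  by (simp add: radial_potential_def)

lemma radial_mean_0:
  fixes g :: "real \<Rightarrow> 'a::euclidean_space"
  assumes "n > 0"
  shows "radial_mean n g 0 = (1 / real n) *\<^sub>R g 0"
proof -
  have 1: "((\<lambda>x::real. x ^ (n - 1)) has_integral 1 / real n) {0..1}"
  proof -
    have "((\<lambda>x::real. x ^ (n - 1)) has_integral (1 ^ n / real n - 0 ^ n / real n)) {0..1}"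
      by (rule fundamental_theorem_of_calculus,
          simp, unfold has_real_derivative_iff_has_vector_derivative[symmetric])
        (use assms in \<open>auto intro!: derivative_eq_intros\<close>)
    then show ?thesis using assms by (simp add: power_0_left)
  qed
  have "((\<lambda>x. x ^ (n - 1) *\<^sub>R g 0) has_integral (1 / real n) *\<^sub>R g 0) {0..1}"
    by (rule has_integral_scaleR_left[OF 1])
  then show ?thesis by (simp add: radial_mean_def integral_unique)
qed

lemma radial_mean_cong:
  assumes "\<And>t. t \<in> {0..T} \<Longrightarrow> g t = h t" "s \<in> {0..T}"
  shows "radial_mean n g s = radial_mean n h s"
  unfolding radial_mean_def
  by (rule integral_cong) (use assms scaled_in_interval in metis)

lemma radial_potential_cong:
  assumes "\<And>t. t \<in> {0..r} \<Longrightarrow> g t = h t"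
  shows "radial_potential n g r = radial_potential n h r"
  unfolding radial_potential_def
  by (rule integral_cong) (use radial_mean_cong[OF assms] in auto)

lemma radial_mean_linear:
  fixes g :: "real \<Rightarrow> 'a::euclidean_space" and h :: "'a \<Rightarrow> 'b::euclidean_space"
  assumes "bounded_linear h" "continuous_on {0..T} g" "s \<in> {0..T}"
  shows "radial_mean n (\<lambda>t. h (g t)) s = h (radial_mean n g s)"
proof -
  interpret bounded_linear h by fact
  show ?thesis
    unfolding radial_mean_def
    using integral_linear[OF radial_mean_integrand_integrable[OF assms(2,3)] assms(1), of "n-1"]
    by (simp add: o_def scaleR)
qed

lemma radial_potential_linear:
  fixes g :: "real \<Rightarrow> 'a::euclidean_space" and h :: "'a \<Rightarrow> 'b::euclidean_space"
  assumes "bounded_linear h" "continuous_on {0..r} g"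
  shows "radial_potential n (\<lambda>t. h (g t)) r = h (radial_potential n g r)"
proof -
  interpret bounded_linear h by fact
  have "radial_potential n (\<lambda>t. h (g t)) r = integral {0..r} (\<lambda>s. h (s *\<^sub>R radial_mean n g s))"
    unfolding radial_potential_def
    by (rule integral_cong) (simp add: radial_mean_linear[OF assms] scaleR)
  also have "\<dots> = h (radial_potential n g r)"
    unfolding radial_potential_def
    using integral_linear[OF radial_potential_integrand_integrable[OF assms(2) order_refl] assms(1)]
    by (simp add: o_def)
  finally show ?thesis .
qed

lemma radial_mean_diff:
  fixes g h :: "real \<Rightarrow> 'a::euclidean_space"
  assumes "continuous_on {0..T} g" "continuous_on {0..T} h" "s \<in> {0..T}"
  shows "radial_mean n (\<lambda>t. g t - h t) s = radial_mean n g s - radial_mean n h s"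
  unfolding radial_mean_def
  using integral_diff[OF radial_mean_integrand_integrable[OF assms(1,3), of "n-1"]
      radial_mean_integrand_integrable[OF assms(2,3), of "n-1"]]
  by (simp add: scaleR_diff_right)

lemma radial_potential_diff:
  fixes g h :: "real \<Rightarrow> 'a::euclidean_space"
  assumes "continuous_on {0..r} g" "continuous_on {0..r} h"
  shows "radial_potential n (\<lambda>t. g t - h t) r = radial_potential n g r - radial_potential n h r"
proof -
  have "radial_potential n (\<lambda>t. g t - h t) r
      = integral {0..r} (\<lambda>s. s *\<^sub>R radial_mean n g s - s *\<^sub>R radial_mean n h s)"
    unfolding radial_potential_def
    by (rule integral_cong) (simp add: radial_mean_diff[OF assms] scaleR_diff_right)
  also have "\<dots> = radial_potential n g r - radial_potential n h r"
    unfolding radial_potential_def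
    by (rule integral_diff) (auto intro: radial_potential_integrand_integrable assms)
  finally show ?thesis .
qed

lemma radial_mean_mono:
  fixes g h :: "real \<Rightarrow> real"
  assumes "continuous_on {0..T} g" "continuous_on {0..T} h" "s \<in> {0..T}"
    and "\<And>t. t \<in> {0..T} \<Longrightarrow> g t \<le> h t"
  shows "radial_mean n g s \<le> radial_mean n h s"
  unfolding radial_mean_def
proof (rule integral_le)
  fix x :: real assume x: "x \<in> {0..1}"
  show "x ^ (n - 1) *\<^sub>R g (s * x) \<le> x ^ (n - 1) *\<^sub>R h (s * x)"
    using assms(4)[OF scaled_in_interval[OF assms(3) x]] x by (simp add: mult_left_mono)
qed (auto intro!: radial_mean_integrand_integrable[OF _ assms(3)] assms(1,2) simp del: real_scaleR_def)

lemma radial_potential_mono: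
  fixes g h :: "real \<Rightarrow> real"
  assumes "continuous_on {0..r} g" "continuous_on {0..r} h"
    and "\<And>t. t \<in> {0..r} \<Longrightarrow> g t \<le> h t"
  shows "radial_potential n g r \<le> radial_potential n h r"
  unfolding radial_potential_def
proof (rule integral_le)
  fix s assume "s \<in> {0..r}"
  then show "s *\<^sub>R radial_mean n g s \<le> s *\<^sub>R radial_mean n h s"
    using radial_mean_mono[OF assms(1,2) _ assms(3), of s n] by (auto intro: mult_left_mono)
qed (auto intro!: radial_potential_integrand_integrable[OF _ order_refl] assms(1,2) simp del: real_scaleR_def)

lemma radial_potential_nonneg:
  fixes g :: "real \<Rightarrow> real"
  assumes "continuous_on {0..r} g" "\<And>t. t \<in> {0..r} \<Longrightarrow> 0 \<le> g t"
  shows "0 \<le> radial_potential n g r"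
proof -
  have "radial_potential n (\<lambda>_. 0::real) r = 0"
    by (simp add: radial_potential_def radial_mean_def)
  then show ?thesis
    using radial_potential_mono[OF continuous_on_const assms(1), of 0 n] assms(2) by (simp del: atLeastAtMost_iff)
qed

lemma norm_radial_mean_le:
  fixes g :: "real \<Rightarrow> 'a::euclidean_space"
  assumes "continuous_on {0..s} g" "s \<ge> 0" "\<And>t. t \<in> {0..s} \<Longrightarrow> norm (g t) \<le> M"
  shows "norm (radial_mean n g s) \<le> M"
proof -
  have M: "M \<ge> 0" using order_trans[OF norm_ge_zero assms(3)[of 0]] assms(2) by simp
  have "norm (radial_mean n g s) \<le> integral {0..1} (\<lambda>x::real. M)"
    unfolding radial_mean_def
  proof (rule integral_norm_bound_integral)
    fix x :: real assume x: "x \<in> {0..1}"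
    have "norm (x ^ (n - 1) *\<^sub>R g (s * x)) \<le> 1 * norm (g (s * x))"
      using x mult_right_mono[OF power_le_one[of x "n - 1"], of "norm (g (s * x))"] by simp
    also have "\<dots> \<le> M" using assms(3)[OF scaled_in_interval[OF _ x]] assms(2) by simp
    finally show "norm (x ^ (n - 1) *\<^sub>R g (s * x)) \<le> M" .
  qed (use assms(2) radial_mean_integrand_integrable[OF assms(1), of s] in \<open>auto simp del: real_scaleR_def\<close>)
  then show ?thesis by simp
qed

lemma norm_radial_potential_diff_le:
  fixes g :: "real \<Rightarrow> 'a::euclidean_space"
  assumes "continuous_on {0..T} g" "\<And>t. t \<in> {0..T} \<Longrightarrow> norm (g t) \<le> B"
    and "a \<in> {0..T}" "b \<in> {0..T}"
  shows "norm (radial_potential n g a - radial_potential n g b) \<le> B * T * \<bar>a - b\<bar>"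
proof -
  have "norm (radial_potential n g a - radial_potential n g b) \<le> B * T * norm (a - b)"
  proof (rule differentiable_bound[where S="{0..T}" and f="radial_potential n g"
        and f'="\<lambda>r h. h *\<^sub>R r *\<^sub>R radial_mean n g r"])
    fix r assume r: "r \<in> {0..T}"
    show "(radial_potential n g has_derivative (\<lambda>h. h *\<^sub>R r *\<^sub>R radial_mean n g r)) (at r within {0..T})"
      using radial_potential_has_vector_derivative[OF assms(1) r] by (simp add: has_vector_derivative_def)
    have "norm (radial_mean n g r) \<le> B"
      by (rule norm_radial_mean_le, rule continuous_on_subset[OF assms(1)]) (use r assms(2) in auto)
    moreover have "B \<ge> 0" using order_trans[OF norm_ge_zero assms(2)[OF r]] .
    ultimately have le: "r * norm (radial_mean n g r) \<le> T * B"
      using r by (intro mult_mono) auto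
    show "onorm (\<lambda>h. h *\<^sub>R r *\<^sub>R radial_mean n g r) \<le> B * T"
    proof (rule onorm_le)
      fix h :: real
      show "norm (h *\<^sub>R r *\<^sub>R radial_mean n g r) \<le> B * T * norm h"
        using mult_right_mono[OF le, of "\<bar>h\<bar>"] r by (simp add: abs_mult mult_ac)
    qed
  qed (use assms in auto)
  then show ?thesis by simp
qed

text \<open>The factor s in the integrand of the potential makes
  \<open>s * exp (c * s\<^sup>2)\<close> explicitly integrable. The gain \<open>1 / (2 * c)\<close>
  turns the integral operator into a contraction in the weighted norm once c is large compared with
  a Lipschitz constant.\<close>

lemma norm_radial_potential_gaussian_le:
  fixes g :: "real \<Rightarrow> 'a::euclidean_space"
  assumes "continuous_on {0..r} g" "r \<ge> 0" "c > 0" "M \<ge> 0"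
    and "\<And>t. t \<in> {0..r} \<Longrightarrow> norm (g t) \<le> M * exp (c * t\<^sup>2)"
  shows "norm (radial_potential n g r) \<le> M * exp (c * r\<^sup>2) / (2 * c)"
proof -
  define G where "G = (\<lambda>s. M / (2 * c) * exp (c * s\<^sup>2))"
  have G: "((\<lambda>s. s * (M * exp (c * s\<^sup>2))) has_integral (G r - G 0)) {0..r}"
  proof (rule fundamental_theorem_of_calculus)
    fix s
    show "(G has_vector_derivative s * (M * exp (c * s\<^sup>2))) (at s within {0..r})"
      unfolding G_def has_real_derivative_iff_has_vector_derivative[symmetric]
      using assms(3) by (auto intro!: derivative_eq_intros simp: field_simps)
  qed fact
  have "norm (radial_potential n g r) \<le> integral {0..r} (\<lambda>s. s * (M * exp (c * s\<^sup>2)))"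
    unfolding radial_potential_def
  proof (rule integral_norm_bound_integral)
    fix s assume s: "s \<in> {0..r}"
    have "norm (radial_mean n g s) \<le> M * exp (c * s\<^sup>2)"
    proof (rule norm_radial_mean_le)
      show "continuous_on {0..s} g" by (rule continuous_on_subset[OF assms(1)]) (use s in auto)
      fix t assume t: "t \<in> {0..s}"
      have "norm (g t) \<le> M * exp (c * t\<^sup>2)" using assms(5) t s by auto
      also have "\<dots> \<le> M * exp (c * s\<^sup>2)"
        using t assms(3,4) by (intro mult_left_mono) (auto simp: power_mono)
      finally show "norm (g t) \<le> M * exp (c * s\<^sup>2)" .
    qed (use s in auto)
    then show "norm (s *\<^sub>R radial_mean n g s) \<le> s * (M * exp (c * s\<^sup>2))"
      using s by (auto intro: mult_left_mono)
  qed (use G radial_potential_integrand_integrable[OF assms(1)] in auto)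
  also have "\<dots> = G r - G 0" using G by (rule integral_unique)
  also have "\<dots> \<le> M * exp (c * r\<^sup>2) / (2 * c)"
    using assms(3,4) by (simp add: G_def)
  finally show ?thesis .
qed

text \<open>The substitution t = r x. The right-hand side, the flux, is additive over intervals and
  differentiable in r even when g is merely continuous.\<close>

lemma radial_mean_power:
  fixes g :: "real \<Rightarrow> 'a::euclidean_space"
  assumes "continuous_on {0..r} g" "r \<ge> 0" "n > 0"
  shows "r ^ n *\<^sub>R radial_mean n g r = integral {0..r} (\<lambda>t. t ^ (n - 1) *\<^sub>R g t)"
proof (cases "r = 0")
  case False
  then have r: "r > 0" using assms by simp
  have im: "(\<lambda>x. x / r) ` {0..r} = {0..1}"
  proof -
    have "x \<in> (\<lambda>x. x / r) ` {0..r}" if "x \<in> {0..1}" for x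
      by (rule image_eqI[of _ _ "x * r"]) (use r that mult_right_mono[of x 1 r] in auto)
    then show ?thesis using r by auto
  qed
  have "r ^ n *\<^sub>R radial_mean n g r = r *\<^sub>R integral {0..1} (\<lambda>x. r ^ (n - 1) *\<^sub>R x ^ (n - 1) *\<^sub>R g (r * x))"
    unfolding radial_mean_def integral_cmul
    using assms(3) by (simp add: power_eq_if)
  also have "integral {0..1} (\<lambda>x. r ^ (n - 1) *\<^sub>R x ^ (n - 1) *\<^sub>R g (r * x))
      = integral ((\<lambda>x. x / r) ` {0..r}) (\<lambda>x. (\<lambda>t. t ^ (n - 1) *\<^sub>R g t) (r * x))"
    unfolding im by (simp add: power_mult_distrib)
  also have "\<dots> = (1 / \<bar>r\<bar>) *\<^sub>R integral {0..r} (\<lambda>t. t ^ (n - 1) *\<^sub>R g t)"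
    by (rule integral_stretch_real) (use r in auto)
  finally show ?thesis using r by simp
qed (use assms in simp)

text \<open>Where \<open>g\<close> is nonnegative the flux \<open>r ^ n * radial_mean n g r\<close> is nondecreasing, so a
  growth of the potential observed on \<open>[a, b]\<close> persists after \<open>b\<close>.\<close>

lemma radial_potential_growth:
  fixes g :: "real \<Rightarrow> real"
  assumes g: "continuous_on {0..T} g" and n: "n > 0"
    and ab: "0 < a" "a < b" "b \<le> T"
    and nn: "\<And>t. t \<in> {a..T} \<Longrightarrow> g t \<ge> 0"
    and k: "k \<ge> 0" "radial_potential n g b - radial_potential n g a \<ge> k"
  shows "radial_potential n g T - radial_potential n g b \<ge> k / (b - a) * (a / T) ^ (n - 1) * (T - b)"
proof (cases "b = T")
  case False
  then have bT: "b < T" using ab by simp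
  define P where "P = radial_potential n g"
  have cont: "continuous_on {0..T} P" unfolding P_def by (rule continuous_on_radial_potential[OF g])
  have der: "(P has_field_derivative s * radial_mean n g s) (at s)" if "0 < s" "s < T" for s
  proof -
    have "(P has_field_derivative s * radial_mean n g s) (at s within {0..T})"
      using radial_potential_has_vector_derivative[OF g, of s n] that
      by (simp add: P_def has_real_derivative_iff_has_vector_derivative)
    moreover have "at s within {0..T} = at s"
      by (rule at_within_interior) (use that in auto)
    ultimately show ?thesis by simp
  qed
  have mvt: "\<exists>z>x. z < y \<and> P y - P x = (y - x) * (z * radial_mean n g z)"
    if "a \<le> x" "x < y" "y \<le> T" for x y
  proof -
    have "continuous_on {x..y} P" by (rule continuous_on_subset[OF cont]) (use that ab in auto)
    moreover have "P differentiable (at z)" if "x < z" "z < y" for z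
      using der[of z] that \<open>a \<le> x\<close> \<open>y \<le> T\<close> ab real_differentiable_def by fastforce
    ultimately obtain l z where z: "x < z" "z < y" "(P has_real_derivative l) (at z)" "P y - P x = (y - x) * l"
      using MVT[OF \<open>x < y\<close>] by blast
    have "l = z * radial_mean n g z"
      using DERIV_unique[OF z(3) der[of z]] z(1,2) that ab by simp
    then show ?thesis using z by blast
  qed
  \<comment> \<open>The derivative \<open>s * radial_mean n g s\<close> of the potential is the flux
    divided by \<open>s ^ (n - 1)\<close>. Passing from the intermediate point z in (a, b) to y in
    (b, T) thus costs the factor \<open>(z / y) ^ (n - 1)\<close>, which is at least
    \<open>(a / T) ^ (n - 1)\<close>.\<close>
  obtain z where z: "a < z" "z < b" "P b - P a = (b - a) * (z * radial_mean n g z)"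
    using mvt[of a b] ab by auto
  obtain y where y: "b < y" "y < T" "P T - P b = (T - b) * (y * radial_mean n g y)"
    using mvt[of b T] ab bT by auto
  have flux: "z ^ n * radial_mean n g z \<le> y ^ n * radial_mean n g y"
  proof -
    have c: "continuous_on {0..y} g" by (rule continuous_on_subset[OF g]) (use y in auto)
    have c': "continuous_on {0..z} g" by (rule continuous_on_subset[OF g]) (use y z in auto)
    have i: "(\<lambda>t. t ^ (n - 1) *\<^sub>R g t) integrable_on {0..y}"
      by (intro integrable_continuous_real continuous_intros c)
    then have "integral {0..y} (\<lambda>t. t ^ (n - 1) *\<^sub>R g t)
        = integral {0..z} (\<lambda>t. t ^ (n - 1) *\<^sub>R g t) + integral {z..y} (\<lambda>t. t ^ (n - 1) *\<^sub>R g t)"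
      by (intro Henstock_Kurzweil_Integration.integral_combine[symmetric]) (use ab y z in auto)
    moreover have "integral {z..y} (\<lambda>t. t ^ (n - 1) *\<^sub>R g t) \<ge> 0"
      by (rule integral_nonneg, rule integrable_subinterval_real[OF i])
        (use y z ab nn in \<open>auto intro!: mult_nonneg_nonneg\<close>)
    ultimately show ?thesis
      using radial_mean_power[OF c _ n] radial_mean_power[OF c' _ n] y z ab by simp
  qed
  have kz: "k / (b - a) \<le> z * radial_mean n g z"
    using k z ab by (simp add: P_def field_simps)
  have pn: "x ^ n = x ^ (n - 1) * x" for x :: real using n by (cases n) auto
  have zT: "a / T \<le> z / y" using z y ab by (simp add: frac_le)
  have "k / (b - a) * (a / T) ^ (n - 1) \<le> (z * radial_mean n g z) * (z / y) ^ (n - 1)"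
    by (intro mult_mono kz power_mono zT) (use kz k z y ab order_trans[OF _ kz] in auto)
  also have "\<dots> = z ^ n * radial_mean n g z / y ^ (n - 1)"
    using y z by (simp add: pn power_divide mult_ac)
  also have "\<dots> \<le> y ^ n * radial_mean n g y / y ^ (n - 1)"
    by (rule divide_right_mono[OF flux]) (use y z ab in auto)
  also have "\<dots> = y * radial_mean n g y"
    using y z ab by (simp add: pn)
  finally have "k / (b - a) * (a / T) ^ (n - 1) \<le> y * radial_mean n g y" .
  from mult_right_mono[OF this, of "T - b"] show ?thesis using bT y(3)
    by (simp add: P_def mult.commute)
qed simp

section \<open>Radial functions on Euclidean space\<close>

lemma has_field_derivative_0_quadratic:
  fixes h :: "real \<Rightarrow> real"
  assumes "h 0 = 0" "\<And>t. \<bar>t\<bar> \<le> 1 \<Longrightarrow> \<bar>h t\<bar> \<le> B * t\<^sup>2"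
  shows "(h has_field_derivative 0) (at 0)"
proof -
  have "((\<lambda>t. h t / t) \<longlongrightarrow> 0) (at 0)"
  proof (rule Lim_null_comparison)
    have "\<bar>h t / t\<bar> \<le> \<bar>B\<bar> * \<bar>t\<bar>" if "\<bar>t\<bar> \<le> 1" "t \<noteq> 0" for t
    proof -
      have "\<bar>h t\<bar> \<le> \<bar>B\<bar> * t\<^sup>2"
        by (rule order_trans[OF assms(2)[OF that(1)]]) (simp add: mult_right_mono)
      then show ?thesis using that
        by (simp add: abs_divide divide_le_eq power2_eq_square mult.assoc)
    qed
    then show "\<forall>\<^sub>F t in at 0. norm (h t / t) \<le> \<bar>B\<bar> * \<bar>t\<bar>"
      unfolding eventually_at by (intro exI[of _ 1]) (auto simp: dist_real_def)
    show "((\<lambda>t. \<bar>B\<bar> * \<bar>t\<bar>) \<longlongrightarrow> 0) (at 0)"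
      by (auto intro!: tendsto_eq_intros)
  qed
  then show ?thesis
    using assms(1) by (simp add: has_field_derivative_iff)
qed

lemma partial_deriv_eqI:
  assumes "((\<lambda>t. g (x + t *\<^sub>R b)) has_field_derivative d) (at 0)"
  shows "partial_deriv b g x = d"
  unfolding partial_deriv_def by (rule DERIV_imp_deriv[OF assms])

lemma norm_line_has_field_derivative:
  fixes x b :: "'a::euclidean_space"
  assumes "x \<noteq> 0"
  shows "((\<lambda>t. norm (x + t *\<^sub>R b)) has_field_derivative (x \<bullet> b) / norm x) (at 0)"
proof -
  have "(norm has_derivative (\<lambda>h. h \<bullet> sgn x)) (at (x + 0 *\<^sub>R b))"
    using has_derivative_norm[OF assms] by (simp add: inner_commute)
  then have "((\<lambda>t. norm (x + t *\<^sub>R b)) has_derivative (\<lambda>t. (t *\<^sub>R b) \<bullet> sgn (x + 0 *\<^sub>R b))) (at 0)"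
    by (rule has_derivative_compose[rotated, where f="\<lambda>t. x + t *\<^sub>R b", THEN has_derivative_eq_rhs])
      (auto intro!: derivative_eq_intros)
  moreover have "(\<lambda>t. (t *\<^sub>R b) \<bullet> sgn (x + 0 *\<^sub>R b)) = (*) ((x \<bullet> b) / norm x)"
    by (auto simp: sgn_div_norm inner_commute fun_eq_iff field_simps)
  ultimately show ?thesis by (simp add: has_field_derivative_def)
qed

text \<open>At \<open>x = 0\<close> the last summand is \<open>0\<close>, since Isabelle's division gives \<open>0 / 0 = 0\<close>.\<close>

definition radial_hessian :: "(real \<Rightarrow> real) \<Rightarrow> 'a::euclidean_space \<Rightarrow> 'a \<Rightarrow> 'a \<Rightarrow> real" where
  "radial_hessian g b c x = - (radial_mean DIM('a) g (norm x) * (b \<bullet> c) +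
    (g (norm x) - DIM('a) * radial_mean DIM('a) g (norm x)) * ((x \<bullet> b) * (x \<bullet> c) / (norm x)\<^sup>2))"

lemma abs_inner_quotient_le:
  fixes x b c :: "'a::euclidean_space"
  assumes "b \<in> Basis" "c \<in> Basis"
  shows "\<bar>(x \<bullet> b) * (x \<bullet> c) / (norm x)\<^sup>2\<bar> \<le> 1"
proof (cases "x = 0")
  case False
  have "\<bar>x \<bullet> b\<bar> * \<bar>x \<bullet> c\<bar> \<le> norm x * norm x"
    by (intro mult_mono Basis_le_norm assms) auto
  then show ?thesis using False by (simp add: abs_mult power2_eq_square divide_le_eq)
qed simp

context
  fixes g :: "real \<Rightarrow> real"
  assumes g_cont: "continuous_on {0..} g"
begin

lemma continuous_on_initial_interval: "continuous_on {0..T} g"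
  by (rule continuous_on_subset[OF g_cont]) auto

lemma radial_potential_has_real_derivative:
  assumes "r > 0"
  shows "(radial_potential n g has_field_derivative r * radial_mean n g r) (at r)"
proof -
  have "(radial_potential n g has_field_derivative r * radial_mean n g r) (at r within {0..r + 1})"
    using radial_potential_has_vector_derivative[OF continuous_on_initial_interval, of r "r + 1" n] assms
    by (simp add: has_real_derivative_iff_has_vector_derivative)
  moreover have "at r within {0..r + 1} = at r"
    by (rule at_within_interior) (use assms in auto)
  ultimately show ?thesis by simp
qed

text \<open>Since g is only continuous, differentiation under the integral sign is not possible.
  Writing the mean as flux over \<open>r ^ n\<close> reduces the claim to the fundamental theorem of
  calculus and the quotient rule.\<close>

lemma radial_mean_has_real_derivative:
  assumes "r > 0" "n > 0"
  shows "(radial_mean n g has_field_derivative (g r - n * radial_mean n g r) / r) (at r)"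
proof -
  define H where "H = (\<lambda>r. integral {0..r} (\<lambda>t. t ^ (n - 1) * g t))"
  have "(H has_vector_derivative r ^ (n - 1) * g r) (at r within {0..r + 1})"
    unfolding H_def
    by (rule integral_has_vector_derivative) (use assms in \<open>auto intro!: continuous_intros continuous_on_initial_interval\<close>)
  moreover have "at r within {0..r + 1} = at r"
    by (rule at_within_interior) (use assms in auto)
  ultimately have H: "(H has_field_derivative r ^ (n - 1) * g r) (at r)"
    by (simp add: has_real_derivative_iff_has_vector_derivative)
  have eq: "radial_mean n g s = H s / s ^ n" if "s > 0" for s
    using radial_mean_power[OF continuous_on_initial_interval, of s n] that assms
    by (simp add: H_def field_simps)
  have pn: "r ^ n = r ^ (n - 1) * r" using assms by (cases n) auto
  have "((\<lambda>s. H s / s ^ n) has_field_derivative (g r - n * radial_mean n g r) / r) (at r)"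
  proof (rule DERIV_cong[OF DERIV_divide[OF H DERIV_pow[of n r]]])
    define A where "A = r ^ (n - 1)"
    have A: "A \<noteq> 0" "r \<noteq> 0" using assms by (auto simp: A_def)
    have "(A * g r * (A * r) - H r * (n * A)) / (A * r * (A * r)) = (g r - n * (H r / (A * r))) / r"
      using A by (simp add: divide_simps) (simp add: algebra_simps)
    then show "(r ^ (n - 1) * g r * r ^ n - H r * (n * r ^ (n - Suc 0))) / (r ^ n * r ^ n)
        = (g r - n * radial_mean n g r) / r"
      unfolding eq[OF assms(1)] pn A_def[symmetric] by (simp add: A_def)
  qed (use assms in simp)
  then show ?thesis
    by (rule has_field_derivative_transform_within_open[of _ _ _ "{0<..}"]) (use assms eq in auto)
qed

lemma continuous_on_radial_mean_norm:
  "continuous_on UNIV (\<lambda>x::'a::euclidean_space. radial_mean n g (norm x))"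
proof -
  have "isCont (\<lambda>x::'a. radial_mean n g (norm x)) x" for x
  proof -
    have "continuous_on (ball 0 (norm x + 1)) (\<lambda>x::'a. radial_mean n g (norm x))"
      by (rule continuous_on_compose2[OF continuous_on_radial_mean[OF continuous_on_initial_interval[of "norm x + 1"]]])
        (auto intro!: continuous_intros)
    then show ?thesis
      by (rule continuous_on_interior) auto
  qed
  then show ?thesis by (simp add: continuous_at_imp_continuous_on)
qed

lemma radial_function_partial_deriv:
  fixes x b :: "'a::euclidean_space"
  assumes b: "b \<in> Basis"
  shows "((\<lambda>t. a - radial_potential n g (norm (x + t *\<^sub>R b))) has_field_derivative
    - (radial_mean n g (norm x) * (x \<bullet> b))) (at 0)"
proof (cases "x = 0")
  case True
  have "bounded (g ` {0..1})"
    by (intro compact_imp_bounded compact_continuous_image continuous_on_initial_interval compact_Icc)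
  then obtain B where B: "\<And>t. t \<in> {0..1} \<Longrightarrow> \<bar>g t\<bar> \<le> B"
    unfolding bounded_iff by (metis imageI real_norm_def)
  have "((\<lambda>t. radial_potential n g \<bar>t\<bar>) has_field_derivative 0) (at 0)"
  proof (rule has_field_derivative_0_quadratic)
    fix t :: real assume "\<bar>t\<bar> \<le> 1"
    then show "\<bar>radial_potential n g \<bar>t\<bar>\<bar> \<le> B * t\<^sup>2"
      using norm_radial_potential_diff_le[OF continuous_on_initial_interval, of "\<bar>t\<bar>" B "\<bar>t\<bar>" 0 n] B
      by (simp add: power2_eq_square mult.assoc)
  qed simp
  then have "((\<lambda>t. a - radial_potential n g \<bar>t\<bar>) has_field_derivative 0) (at 0)"
    by (auto intro!: derivative_eq_intros)
  then show ?thesis using True b by simp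
next
  case False
  have "((\<lambda>t. radial_potential n g (norm (x + t *\<^sub>R b))) has_field_derivative
      (norm x * radial_mean n g (norm x)) * ((x \<bullet> b) / norm x)) (at 0)"
    by (rule DERIV_chain2[OF _ norm_line_has_field_derivative[OF False]])
      (use radial_potential_has_real_derivative[of "norm x" n] False in simp)
  then have "((\<lambda>t. a - radial_potential n g (norm (x + t *\<^sub>R b))) has_field_derivative
      0 - (norm x * radial_mean n g (norm x)) * ((x \<bullet> b) / norm x)) (at 0)"
    by (intro DERIV_diff DERIV_const)
  then show ?thesis using False by simp
qed

text \<open>At the origin the function is t times a continuous function of t, so Caratheodory's
  criterion applies; elsewhere the chain and product rules do.\<close>

lemma radial_gradient_partial_deriv:
  fixes x b c :: "'a::euclidean_space"
  assumes b: "b \<in> Basis"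
  shows "((\<lambda>t. - (radial_mean DIM('a) g (norm (x + t *\<^sub>R b)) * ((x + t *\<^sub>R b) \<bullet> c))) has_field_derivative
    radial_hessian g b c x) (at 0)"
proof (cases "x = 0")
  case True
  have "isCont (\<lambda>t. - (radial_mean DIM('a) g (norm (t *\<^sub>R b)) * (b \<bullet> c))) 0"
    by (intro continuous_intros)
      (use continuous_on_compose2[OF continuous_on_radial_mean_norm, of UNIV "\<lambda>t. t *\<^sub>R b"] in
        \<open>auto intro!: continuous_intros simp: continuous_on_eq_continuous_at\<close>)
  then show ?thesis
    unfolding CARAT_DERIV using True b
    by (intro exI[of _ "\<lambda>t. - (radial_mean DIM('a) g (norm (t *\<^sub>R b)) * (b \<bullet> c))"])
      (simp add: radial_hessian_def)
next
  case False
  have m: "((\<lambda>t. radial_mean DIM('a) g (norm (x + t *\<^sub>R b))) has_field_derivative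
      ((g (norm x) - DIM('a) * radial_mean DIM('a) g (norm x)) / norm x) * ((x \<bullet> b) / norm x)) (at 0)"
    by (rule DERIV_chain2[OF _ norm_line_has_field_derivative[OF False]])
      (use radial_mean_has_real_derivative[of "norm x" "DIM('a)"] False in simp)
  have l: "((\<lambda>t. (x + t *\<^sub>R b) \<bullet> c) has_field_derivative b \<bullet> c) (at 0)"
    unfolding inner_add_left inner_scaleR_left by (auto intro!: derivative_eq_intros)
  show ?thesis
    by (rule DERIV_cong[OF DERIV_minus[OF DERIV_mult[OF m l]]])
      (simp add: radial_hessian_def power2_eq_square)
qed

lemma continuous_on_g_norm: "continuous_on UNIV (\<lambda>x::'a::euclidean_space. g (norm x))"
  by (rule continuous_on_compose2[OF g_cont]) (auto intro!: continuous_intros)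

text \<open>The angular quotient has no limit at the origin in general, but it is bounded by 1, and
  its coefficient tends to \<open>g 0 - DIM('a) * radial_mean DIM('a) g 0\<close>, which is 0 by
  \<open>radial_mean_0\<close>.\<close>

lemma continuous_on_radial_hessian:
  fixes b c :: "'a::euclidean_space"
  assumes "b \<in> Basis" "c \<in> Basis"
  shows "continuous_on UNIV (radial_hessian g b c)"
proof -
  define q where "q = (\<lambda>x::'a. g (norm x) - DIM('a) * radial_mean DIM('a) g (norm x))"
  have q: "continuous_on UNIV q"
    unfolding q_def by (intro continuous_intros continuous_on_g_norm continuous_on_radial_mean_norm)
  then have qx: "isCont q x" for x by (simp add: continuous_on_eq_continuous_at)
  have q0: "q 0 = 0" by (simp add: q_def radial_mean_0)
  have "isCont (\<lambda>x. q x * ((x \<bullet> b) * (x \<bullet> c) / (norm x)\<^sup>2)) x" for x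
  proof (cases "x = 0")
    case True
    have "((\<lambda>x. q x * ((x \<bullet> b) * (x \<bullet> c) / (norm x)\<^sup>2)) \<longlongrightarrow> 0) (at 0)"
    proof (rule Lim_null_comparison)
      show "((\<lambda>x. \<bar>q x\<bar>) \<longlongrightarrow> 0) (at 0)"
        using qx[of 0] q0 by (simp add: isCont_def tendsto_rabs_zero)
      show "\<forall>\<^sub>F x in at 0. norm (q x * ((x \<bullet> b) * (x \<bullet> c) / (norm x)\<^sup>2)) \<le> \<bar>q x\<bar>"
        unfolding real_norm_def abs_mult
        by (intro always_eventually allI mult_right_le_one_le[OF abs_ge_zero])
          (use abs_inner_quotient_le[OF assms] in \<open>auto simp: abs_mult\<close>)
    qed
    then show ?thesis using True q0 by (simp add: isCont_def)
  next
    case False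
    then have "isCont (\<lambda>x. (x \<bullet> b) * (x \<bullet> c) / (norm x)\<^sup>2) x"
      by (intro continuous_intros) auto
    from continuous_mult[OF qx this] show ?thesis .
  qed
  then have "continuous_on UNIV (\<lambda>x. q x * ((x \<bullet> b) * (x \<bullet> c) / (norm x)\<^sup>2))"
    by (simp add: continuous_at_imp_continuous_on)
  then have "continuous_on UNIV (\<lambda>x. - (radial_mean DIM('a) g (norm x) * (b \<bullet> c)
      + q x * ((x \<bullet> b) * (x \<bullet> c) / (norm x)\<^sup>2)))"
    by (intro continuous_on_minus continuous_on_add continuous_on_mult_right continuous_on_radial_mean_norm)
  then show ?thesis
    by (simp add: radial_hessian_def[abs_def] q_def)
qed

lemma partial_deriv_radial_function:
  fixes b :: "'a::euclidean_space"
  assumes "b \<in> Basis"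
  shows "partial_deriv b (\<lambda>x::'a. a - radial_potential n g (norm x))
    = (\<lambda>x. - (radial_mean n g (norm x) * (x \<bullet> b)))"
  by (intro ext partial_deriv_eqI radial_function_partial_deriv assms)

lemma partial_deriv2_radial_function:
  fixes b c :: "'a::euclidean_space"
  assumes "b \<in> Basis" "c \<in> Basis"
  shows "partial_deriv b (partial_deriv c (\<lambda>x::'a. a - radial_potential DIM('a) g (norm x)))
    = radial_hessian g b c"
  unfolding partial_deriv_radial_function[OF assms(2)]
  by (intro ext partial_deriv_eqI radial_gradient_partial_deriv assms)

text \<open>In the trace the angular quotients add up to 1 away from the origin, so that the two
  multiples of the mean cancel. At the origin they add up to 0, and \<open>DIM('a)\<close> times the
  mean is already \<open>g 0\<close>.\<close>

lemma laplacian_radial_function: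
  fixes x :: "'a::euclidean_space"
  shows "laplacian (\<lambda>x::'a. a - radial_potential DIM('a) g (norm x)) x = - g (norm x)"
proof -
  have "(\<Sum>b\<in>Basis. (x \<bullet> b) * (x \<bullet> b) / (norm x)\<^sup>2) = (if x = 0 then 0 else 1)"
    by (simp add: sum_divide_distrib[symmetric] euclidean_inner[symmetric] dot_square_norm)
  then have "(\<Sum>b\<in>Basis. radial_hessian g b b x) =
      - (DIM('a) * radial_mean DIM('a) g (norm x) +
      (g (norm x) - DIM('a) * radial_mean DIM('a) g (norm x)) * (if x = 0 then 0 else 1))"
    by (simp only: radial_hessian_def sum_negf sum.distrib sum_distrib_left[symmetric]) simp
  moreover have "laplacian (\<lambda>x::'a. a - radial_potential DIM('a) g (norm x)) x = (\<Sum>b\<in>Basis. radial_hessian g b b x)"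
    unfolding laplacian_def by (simp add: partial_deriv2_radial_function)
  ultimately show ?thesis by (simp add: radial_mean_0)
qed

lemma Ck_on_2_radial_function:
  "Ck_on 2 S (\<lambda>x::'a::euclidean_space. a - radial_potential DIM('a) g (norm x))"
proof -
  define U where "U = (\<lambda>x::'a. a - radial_potential DIM('a) g (norm x))"
  have d1: "partial_deriv b U = (\<lambda>x. - (radial_mean DIM('a) g (norm x) * (x \<bullet> b)))"
    if "b \<in> Basis" for b :: 'a
    unfolding U_def by (rule partial_deriv_radial_function[OF that])
  have d2: "partial_deriv b (\<lambda>x. - (radial_mean DIM('a) g (norm x) * (x \<bullet> c))) = radial_hessian g b c"
    if "b \<in> Basis" "c \<in> Basis" for b c :: 'a
    using partial_deriv2_radial_function[OF that, of a]
    unfolding partial_deriv_radial_function[OF that(2)] .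
  have "continuous_on S (\<lambda>x::'a. radial_mean DIM('a) g (norm x))"
    by (rule continuous_on_subset[OF continuous_on_radial_mean_norm]) simp
  moreover have "continuous_on S U"
  proof -
    have "isCont U x" for x
    proof -
      have "continuous_on (ball 0 (norm x + 1)) U"
        unfolding U_def
        by (intro continuous_intros continuous_on_compose2[OF
              continuous_on_radial_potential[OF continuous_on_initial_interval[of "norm x + 1"]]]) auto
      then show ?thesis by (rule continuous_on_interior) auto
    qed
    then show ?thesis by (simp add: continuous_at_imp_continuous_on)
  qed
  moreover have "(\<lambda>t. U (x + t *\<^sub>R b)) field_differentiable at 0" if "b \<in> Basis" for x b
    using radial_function_partial_deriv[OF that, of a "DIM('a)" x]
    unfolding U_def field_differentiable_def by blast
  moreover have "(\<lambda>t. - (radial_mean DIM('a) g (norm (x + t *\<^sub>R b)) * ((x + t *\<^sub>R b) \<bullet> c)))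
      field_differentiable at 0" if "b \<in> Basis" for x b c :: 'a
    using radial_gradient_partial_deriv[OF that, of x c]
    unfolding field_differentiable_def by blast
  moreover have "continuous_on S (radial_hessian g b c)" if "b \<in> Basis" "c \<in> Basis" for b c :: 'a
    by (rule continuous_on_subset[OF continuous_on_radial_hessian[OF that]]) simp
  ultimately show ?thesis
    unfolding U_def[symmetric]
    by (auto simp: numeral_2_eq_2 d1 d2 simp del: inner_add_left intro!: continuous_intros)
qed

lemma radial_mean_lipschitz:
  fixes L R :: real
  assumes "L \<ge> 0" "\<And>s t. s \<in> {0..R} \<Longrightarrow> t \<in> {0..R} \<Longrightarrow> \<bar>g s - g t\<bar> \<le> L * \<bar>s - t\<bar>"
    and st: "s \<in> {0..R}" "t \<in> {0..R}"
  shows "\<bar>radial_mean n g s - radial_mean n g t\<bar> \<le> L * \<bar>s - t\<bar>"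
proof -
  have "radial_mean n g s - radial_mean n g t
      = integral {0..1} (\<lambda>x. x ^ (n - 1) *\<^sub>R g (s * x) - x ^ (n - 1) *\<^sub>R g (t * x))"
    unfolding radial_mean_def
    by (rule integral_diff[symmetric]) (auto intro!: radial_mean_integrand_integrable[OF continuous_on_initial_interval] st simp del: real_scaleR_def)
  also have "norm \<dots> \<le> integral {0..1} (\<lambda>x::real. L * \<bar>s - t\<bar>)"
  proof (rule integral_norm_bound_integral)
    fix x :: real assume x: "x \<in> {0..1}"
    have "\<bar>g (s * x) - g (t * x)\<bar> \<le> L * \<bar>s * x - t * x\<bar>"
      by (rule assms(2)) (use scaled_in_interval x st in blast)+
    also have "\<dots> = L * \<bar>s - t\<bar> * x"
      using x by (simp add: abs_mult left_diff_distrib[symmetric])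
    also have "\<dots> \<le> L * \<bar>s - t\<bar>"
      using x assms(1) by (simp add: mult_left_le)
    finally have "\<bar>g (s * x) - g (t * x)\<bar> \<le> L * \<bar>s - t\<bar>" .
    from mult_mono[OF power_le_one[of x "n - 1"] this]
    show "norm (x ^ (n - 1) *\<^sub>R g (s * x) - x ^ (n - 1) *\<^sub>R g (t * x)) \<le> L * \<bar>s - t\<bar>"
      using x by (simp add: abs_mult right_diff_distrib[symmetric])
  qed (intro integrable_diff radial_mean_integrand_integrable[OF continuous_on_initial_interval st(1)]
      radial_mean_integrand_integrable[OF continuous_on_initial_interval st(2)] integrable_const_ivl)+
  finally show ?thesis by simp
qed

end

section \<open>Local Hoelder bounds for the second derivatives of radial functions\<close>

lemma direction_diff_le:
  fixes x y :: "'a::real_inner"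
  assumes "x \<noteq> 0" "y \<noteq> 0"
  shows "norm y * norm (x /\<^sub>R norm x - y /\<^sub>R norm y) \<le> 2 * norm (x - y)"
proof -
  have "norm y * norm (x /\<^sub>R norm x - y /\<^sub>R norm y) = norm (norm y *\<^sub>R (x /\<^sub>R norm x - y /\<^sub>R norm y))"
    by simp
  also have "norm y *\<^sub>R (x /\<^sub>R norm x - y /\<^sub>R norm y) = ((norm y - norm x) / norm x) *\<^sub>R x + (x - y)"
    using assms by (simp add: scaleR_diff_right divide_inverse algebra_simps)
  also have "norm \<dots> \<le> norm (((norm y - norm x) / norm x) *\<^sub>R x) + norm (x - y)"
    by (rule norm_triangle_ineq)
  also have "\<dots> = \<bar>norm y - norm x\<bar> + norm (x - y)"
    using assms by simp
  also have "\<dots> \<le> 2 * norm (x - y)"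
    using norm_triangle_ineq3[of x y] by simp
  finally show ?thesis .
qed

text \<open>The quotient depends only on the direction of its argument and is not Lipschitz at the
  origin; the weight \<open>norm y\<close> compensates for this. One factor 2 comes from the product
  of two coordinates, the other from \<open>direction_diff_le\<close>.\<close>

lemma inner_quotient_diff_le:
  fixes x y b c :: "'a::euclidean_space"
  assumes "b \<in> Basis" "c \<in> Basis"
  shows "norm y * \<bar>(x \<bullet> b) * (x \<bullet> c) / (norm x)\<^sup>2 - (y \<bullet> b) * (y \<bullet> c) / (norm y)\<^sup>2\<bar> \<le> 4 * norm (x - y)"
proof (cases "x = 0 \<or> y = 0")
  case True
  have "norm y * \<bar>(y \<bullet> b) * (y \<bullet> c) / (norm y)\<^sup>2\<bar> \<le> norm y * 1"
    by (rule mult_left_mono[OF abs_inner_quotient_le[OF assms] norm_ge_zero])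
  then have "norm y * \<bar>(y \<bullet> b) * (y \<bullet> c) / (norm y)\<^sup>2\<bar> \<le> 4 * norm y"
    using norm_ge_zero[of y] by linarith
  then show ?thesis using True by auto
next
  case False
  define \<xi> \<eta> where "\<xi> = x /\<^sub>R norm x" and "\<eta> = y /\<^sub>R norm y"
  have "\<bar>(\<xi> \<bullet> b) * (\<xi> \<bullet> c) - (\<eta> \<bullet> b) * (\<eta> \<bullet> c)\<bar> = \<bar>((\<xi> - \<eta>) \<bullet> b) * (\<xi> \<bullet> c) + (\<eta> \<bullet> b) * ((\<xi> - \<eta>) \<bullet> c)\<bar>"
    by (simp add: algebra_simps)
  also have "\<dots> \<le> \<bar>(\<xi> - \<eta>) \<bullet> b\<bar> * \<bar>\<xi> \<bullet> c\<bar> + \<bar>\<eta> \<bullet> b\<bar> * \<bar>(\<xi> - \<eta>) \<bullet> c\<bar>"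
    by (rule order_trans[OF abs_triangle_ineq]) (simp add: abs_mult)
  also have "\<dots> \<le> norm (\<xi> - \<eta>) * norm \<xi> + norm \<eta> * norm (\<xi> - \<eta>)"
    by (intro add_mono mult_mono Basis_le_norm assms) auto
  also have "\<dots> = 2 * norm (\<xi> - \<eta>)"
    using False by (simp add: \<xi>_def \<eta>_def)
  finally have "norm y * \<bar>(\<xi> \<bullet> b) * (\<xi> \<bullet> c) - (\<eta> \<bullet> b) * (\<eta> \<bullet> c)\<bar> \<le> norm y * (2 * norm (\<xi> - \<eta>))"
    by (rule mult_left_mono) simp
  also have "\<dots> \<le> 4 * norm (x - y)"
    using direction_diff_le[of x y] False by (simp add: \<xi>_def \<eta>_def)
  finally show ?thesis
    by (simp add: \<xi>_def \<eta>_def power2_eq_square divide_inverse mult_ac)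
qed

text \<open>The coefficient q of the angular quotient is Lipschitz with constant K and vanishes at
  0, so \<open>\<bar>q (norm y)\<bar> \<le> K * norm y\<close> supplies exactly the weight required
  by \<open>inner_quotient_diff_le\<close>. In the constant, L belongs to the mean and 5 = 1 + 4 to
  the two parts of the product difference.\<close>

lemma radial_hessian_lipschitz:
  fixes L R :: real and x y b c :: "'a::euclidean_space"
  assumes g: "continuous_on {0..} g" and L: "L \<ge> 0"
    and lip: "\<And>s t. s \<in> {0..R} \<Longrightarrow> t \<in> {0..R} \<Longrightarrow> \<bar>g s - g t\<bar> \<le> L * \<bar>s - t\<bar>"
    and bc: "b \<in> Basis" "c \<in> Basis" and xy: "norm x \<le> R" "norm y \<le> R"
  shows "\<bar>radial_hessian g b c x - radial_hessian g b c y\<bar> \<le> (L + 5 * (L + DIM('a) * L)) * norm (x - y)"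
proof -
  define m where "m = radial_mean DIM('a) g"
  define q where "q = (\<lambda>r. g r - DIM('a) * m r)"
  define e where "e = (\<lambda>x. (x \<bullet> b) * (x \<bullet> c) / (norm x)\<^sup>2)"
  define K where "K = L + DIM('a) * L"
  have K: "K \<ge> 0" using L by (simp add: K_def)
  have m: "\<bar>m s - m t\<bar> \<le> L * \<bar>s - t\<bar>" if "s \<in> {0..R}" "t \<in> {0..R}" for s t
    unfolding m_def by (rule radial_mean_lipschitz[OF g L lip that])
  have q: "\<bar>q s - q t\<bar> \<le> K * \<bar>s - t\<bar>" if "s \<in> {0..R}" "t \<in> {0..R}" for s t
  proof -
    have "\<bar>q s - q t\<bar> = \<bar>(g s - g t) - DIM('a) * (m s - m t)\<bar>"
      by (simp add: q_def algebra_simps)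
    also have "\<dots> \<le> \<bar>g s - g t\<bar> + DIM('a) * \<bar>m s - m t\<bar>"
      by (rule order_trans[OF abs_triangle_ineq4]) (simp add: abs_mult)
    also have "\<dots> \<le> L * \<bar>s - t\<bar> + DIM('a) * (L * \<bar>s - t\<bar>)"
      by (intro add_mono lip m mult_left_mono that) auto
    finally show ?thesis by (simp add: K_def algebra_simps)
  qed
  have q0: "q 0 = 0" by (simp add: q_def m_def radial_mean_0)
  have d: "\<bar>norm x - norm y\<bar> \<le> norm (x - y)" by (rule norm_triangle_ineq3)
  have "\<bar>(q (norm x) - q (norm y)) * e x\<bar> \<le> K * norm (x - y)"
  proof -
    have "\<bar>q (norm x) - q (norm y)\<bar> * \<bar>e x\<bar> \<le> \<bar>q (norm x) - q (norm y)\<bar> * 1"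
      unfolding e_def by (rule mult_left_mono[OF abs_inner_quotient_le[OF bc]]) simp
    also have "\<dots> \<le> K * \<bar>norm x - norm y\<bar>" using q[of "norm x" "norm y"] xy by simp
    also have "\<dots> \<le> K * norm (x - y)" by (rule mult_left_mono[OF d K])
    finally show ?thesis by (simp add: abs_mult)
  qed
  moreover have "\<bar>q (norm y) * (e x - e y)\<bar> \<le> K * (4 * norm (x - y))"
  proof -
    have "\<bar>q (norm y)\<bar> * \<bar>e x - e y\<bar> \<le> (K * norm y) * \<bar>e x - e y\<bar>"
      using q[of "norm y" 0] q0 xy order_trans[OF norm_ge_zero xy(2)] by (intro mult_right_mono) auto
    also have "\<dots> = K * (norm y * \<bar>e x - e y\<bar>)" by simp
    also have "\<dots> \<le> K * (4 * norm (x - y))"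
      unfolding e_def by (rule mult_left_mono[OF inner_quotient_diff_le[OF bc] K])
    finally show ?thesis by (simp add: abs_mult)
  qed
  moreover have "\<bar>(m (norm x) - m (norm y)) * (b \<bullet> c)\<bar> \<le> L * norm (x - y)"
  proof -
    have "\<bar>m (norm x) - m (norm y)\<bar> * \<bar>b \<bullet> c\<bar> \<le> \<bar>m (norm x) - m (norm y)\<bar> * 1"
      by (rule mult_left_mono) (use bc in \<open>auto simp: inner_Basis\<close>)
    also have "\<dots> \<le> L * \<bar>norm x - norm y\<bar>" using m[of "norm x" "norm y"] xy by simp
    also have "\<dots> \<le> L * norm (x - y)" by (rule mult_left_mono[OF d L])
    finally show ?thesis by (simp add: abs_mult)
  qed
  moreover have "radial_hessian g b c x - radial_hessian g b c y = - ((m (norm x) - m (norm y)) * (b \<bullet> c)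
      + (q (norm x) - q (norm y)) * e x + q (norm y) * (e x - e y))"
  proof -
    have h: "radial_hessian g b c z = - (m (norm z) * (b \<bullet> c) + q (norm z) * e z)" for z
      by (simp add: radial_hessian_def m_def q_def e_def)
    show ?thesis unfolding h by (simp add: algebra_simps)
  qed
  moreover have "(L + 5 * K) * norm (x - y) = L * norm (x - y) + K * norm (x - y) + K * (4 * norm (x - y))"
    by (simp add: algebra_simps)
  ultimately show ?thesis unfolding K_def[symmetric] by linarith
qed

text \<open>Split the distance d as d^(1-\<gamma>) d^\<gamma>; on a set of norm at most R the first
  factor is at most (2R)^(1-\<gamma>).\<close>

lemma locally_holder_on_lipschitz_cball:
  fixes h :: "'a::euclidean_space \<Rightarrow> real"
  assumes "\<And>R. \<exists>M. \<forall>x y. norm x \<le> R \<longrightarrow> norm y \<le> R \<longrightarrow> \<bar>h x - h y\<bar> \<le> M * norm (x - y)"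
    and "0 < \<gamma>" "\<gamma> < 1"
  shows "locally_holder_on \<gamma> S h"
  unfolding locally_holder_on_def
proof (intro allI impI)
  fix C :: "'a set" assume "compact C \<and> C \<subseteq> S"
  then have "bounded C" using compact_imp_bounded by blast
  then obtain R where R: "\<And>x. x \<in> C \<Longrightarrow> norm x \<le> R" by (auto simp: bounded_iff)
  obtain M where M: "\<And>x y. norm x \<le> R \<Longrightarrow> norm y \<le> R \<Longrightarrow> \<bar>h x - h y\<bar> \<le> M * norm (x - y)"
    using assms(1)[of R] by blast
  show "\<exists>K. \<forall>x\<in>C. \<forall>y\<in>C. \<bar>h x - h y\<bar> \<le> K * dist x y powr \<gamma>"
  proof (intro exI ballI)
    fix x y assume xy: "x \<in> C" "y \<in> C"
    have "\<bar>h x - h y\<bar> \<le> \<bar>M\<bar> * dist x y"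
      using M[OF R[OF xy(1)] R[OF xy(2)]] mult_right_mono[OF abs_ge_self[of M], of "dist x y"]
      by (simp add: dist_norm)
    also have "dist x y = dist x y powr (1 - \<gamma>) * dist x y powr \<gamma>"
      by (simp add: powr_add[symmetric])
    also have "\<bar>M\<bar> * \<dots> \<le> \<bar>M\<bar> * ((2 * R) powr (1 - \<gamma>) * dist x y powr \<gamma>)"
    proof (intro mult_left_mono mult_right_mono powr_mono2)
      show "dist x y \<le> 2 * R"
        using R[OF xy(1)] R[OF xy(2)] norm_triangle_ineq4[of x y] by (simp add: dist_norm)
    qed (use assms in auto)
    finally show "\<bar>h x - h y\<bar> \<le> \<bar>M\<bar> * (2 * R) powr (1 - \<gamma>) * dist x y powr \<gamma>"
      by (simp add: mult.assoc)
  qed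
qed

lemma C2_holder_on_radial_function:
  fixes g :: "real \<Rightarrow> real"
  assumes g: "continuous_on {0..} g"
    and lip: "\<And>R. \<exists>L. L-lipschitz_on {0..R} g"
    and "0 < \<gamma>" "\<gamma> < 1"
  shows "C2_holder_on \<gamma> S (\<lambda>x::'a::euclidean_space. a - radial_potential DIM('a) g (norm x))"
  unfolding C2_holder_on_def
proof (intro conjI ballI)
  fix b c :: 'a assume bc: "b \<in> Basis" "c \<in> Basis"
  show "locally_holder_on \<gamma> S (partial_deriv b (partial_deriv c (\<lambda>x::'a. a - radial_potential DIM('a) g (norm x))))"
    unfolding partial_deriv2_radial_function[OF g bc]
  proof (rule locally_holder_on_lipschitz_cball)
    fix R
    obtain L where "L-lipschitz_on {0..R} g" using lip by blast
    then have "L \<ge> 0" "\<And>s t. s \<in> {0..R} \<Longrightarrow> t \<in> {0..R} \<Longrightarrow> \<bar>g s - g t\<bar> \<le> L * \<bar>s - t\<bar>"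
      using lipschitz_on_nonneg by (auto simp: lipschitz_on_def dist_real_def)
    from radial_hessian_lipschitz[OF g this bc]
    show "\<exists>M. \<forall>x y::'a. norm x \<le> R \<longrightarrow> norm y \<le> R \<longrightarrow>
        \<bar>radial_hessian g b c x - radial_hessian g b c y\<bar> \<le> M * norm (x - y)"
      by blast
  qed (use assms in auto)
qed (rule Ck_on_2_radial_function[OF g])

section \<open>The radial integral equation\<close>

text \<open>A Gronwall argument by weights: at a point s where
  \<open>norm (u t - v t) * exp (- (c * t\<^sup>2))\<close> is maximal, the potential term is at
  most half of \<open>norm (u s - v s)\<close> and can be absorbed, which produces the factor 2.
  With c = L + 1 the weight is positive and L / (2c) is at most 1/2.\<close>

lemma radial_equation_stability:
  fixes u v :: "real \<Rightarrow> 'a::euclidean_space" and F :: "'a \<Rightarrow> 'a"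
  assumes u: "continuous_on {0..T} u" and v: "continuous_on {0..T} v" and F: "L-lipschitz_on S F"
    and S: "\<And>t. t \<in> {0..T} \<Longrightarrow> u t \<in> S" "\<And>t. t \<in> {0..T} \<Longrightarrow> v t \<in> S"
    and ueq: "\<And>r. r \<in> {0..T} \<Longrightarrow> u r = a - radial_potential n (\<lambda>t. F (u t)) r"
    and veq: "\<And>r. r \<in> {0..T} \<Longrightarrow> v r = b - radial_potential n (\<lambda>t. F (v t)) r"
    and r: "r \<in> {0..T}"
  shows "norm (u r - v r) \<le> 2 * norm (a - b) * exp ((L + 1) * r\<^sup>2)"
proof -
  define c where "c = L + 1"
  have L: "L \<ge> 0" using F by (rule lipschitz_on_nonneg)
  then have c: "c > 0" "L \<le> c" by (auto simp: c_def)
  define h where "h = (\<lambda>t. norm (u t - v t) * exp (- (c * t\<^sup>2)))"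
  have "continuous_on {0..T} h" unfolding h_def by (intro continuous_intros u v)
  then obtain s where s: "s \<in> {0..T}" and max: "\<And>t. t \<in> {0..T} \<Longrightarrow> h t \<le> h s"
    using continuous_attains_sup[of "{0..T}" h] r by force
  have diff: "norm (u t - v t) \<le> h s * exp (c * t\<^sup>2)" if "t \<in> {0..T}" for t
    using max[OF that] by (simp add: h_def exp_minus field_simps)
  have sub: "{0..s} \<subseteq> {0..T}" using s by auto
  have Fu: "continuous_on {0..s} (\<lambda>t. F (u t))" and Fv: "continuous_on {0..s} (\<lambda>t. F (v t))"
    by (rule continuous_on_compose2[OF lipschitz_on_continuous_on[OF F]];
        use S sub in \<open>auto intro: continuous_on_subset[OF u] continuous_on_subset[OF v]\<close>)+
  have "norm (radial_potential n (\<lambda>t. F (u t) - F (v t)) s) \<le> (L * h s) * exp (c * s\<^sup>2) / (2 * c)"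
  proof (rule norm_radial_potential_gaussian_le)
    fix t assume "t \<in> {0..s}"
    then have t: "t \<in> {0..T}" using sub by blast
    have "norm (F (u t) - F (v t)) \<le> L * norm (u t - v t)"
      using lipschitz_onD[OF F S(1)[OF t] S(2)[OF t]] by (simp add: dist_norm)
    also have "\<dots> \<le> L * (h s * exp (c * t\<^sup>2))"
      by (rule mult_left_mono[OF diff[OF t] L])
    finally show "norm (F (u t) - F (v t)) \<le> (L * h s) * exp (c * t\<^sup>2)" by simp
  qed (use s c L in \<open>auto intro!: continuous_intros Fu Fv simp: h_def\<close>)
  also have "\<dots> \<le> h s * exp (c * s\<^sup>2) / 2"
  proof -
    have "L * (h s * exp (c * s\<^sup>2)) \<le> c * (h s * exp (c * s\<^sup>2))"
      by (rule mult_right_mono[OF c(2)]) (simp add: h_def)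
    then show ?thesis using c by (simp add: field_simps)
  qed
  finally have pot: "norm (radial_potential n (\<lambda>t. F (u t) - F (v t)) s) \<le> h s * exp (c * s\<^sup>2) / 2" .
  have "u s - v s = (a - b) - radial_potential n (\<lambda>t. F (u t) - F (v t)) s"
    using ueq[OF s] veq[OF s] radial_potential_diff[OF Fu Fv, of n] by simp
  then have "norm (u s - v s) \<le> norm (a - b) + h s * exp (c * s\<^sup>2) / 2"
    using norm_triangle_ineq4[of "a - b" "radial_potential n (\<lambda>t. F (u t) - F (v t)) s"] pot by simp
  moreover have "norm (u s - v s) = h s * exp (c * s\<^sup>2)"
    by (simp add: h_def exp_minus)
  ultimately have "h s * exp (c * s\<^sup>2) \<le> 2 * norm (a - b)" by simp
  moreover have "h s * 1 \<le> h s * exp (c * s\<^sup>2)"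
    by (rule mult_left_mono) (use c in \<open>auto simp: h_def\<close>)
  ultimately have "h s \<le> 2 * norm (a - b)" by simp
  then have "h s * exp (c * r\<^sup>2) \<le> 2 * norm (a - b) * exp (c * r\<^sup>2)" by (rule mult_right_mono) simp
  from order_trans[OF diff[OF r] this] show ?thesis unfolding c_def .
qed

text \<open>Banach's theorem for \<open>t \<mapsto> exp (- c t\<^sup>2) u t\<close>: the weight makes the integral operator a
  contraction on the whole half-line.\<close>

lemma radial_equation_global_solution:
  fixes F :: "'a::euclidean_space \<Rightarrow> 'a"
  assumes F: "L-lipschitz_on UNIV F" and B: "\<And>x. norm (F x) \<le> B"
  obtains u where "continuous_on {0..} u"
    "\<And>r. r \<ge> 0 \<Longrightarrow> u r = a - radial_potential n (\<lambda>t. F (u t)) r"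
proof -
  define c where "c = L + 1"
  have L: "L \<ge> 0" using F by (rule lipschitz_on_nonneg)
  then have c: "c > 0" "L \<le> c" by (auto simp: c_def)
  have B0: "B \<ge> 0" using order_trans[OF norm_ge_zero B] .
  define G where "G = (\<lambda>(v::real \<Rightarrow>\<^sub>C 'a) t. F (exp (c * t\<^sup>2) *\<^sub>R v t))"
  have G: "continuous_on A (G v)" for A v
    unfolding G_def
    by (rule continuous_on_compose2[OF lipschitz_on_continuous_on[OF F]]) (auto intro!: continuous_intros)
  \<comment> \<open>Bounded continuous functions live on the whole line, so the potential is frozen
    at its value 0 for negative r by \<open>max 0 r\<close>; only r \<ge> 0 enters the
    equation.\<close>
  define \<Phi> where "\<Phi> = (\<lambda>v r. exp (- (c * r\<^sup>2)) *\<^sub>R (a - radial_potential n (G v) (max 0 r)))"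
  have cont_pot: "continuous_on UNIV (\<lambda>r. radial_potential n (G v) (max 0 r))" for v
  proof -
    have "isCont (\<lambda>r. radial_potential n (G v) (max 0 r)) r" for r
    proof -
      have "continuous_on {r - 1..r + 1} (\<lambda>r. radial_potential n (G v) (max 0 r))"
        by (rule continuous_on_compose2[OF continuous_on_radial_potential[OF G, of "max 0 (r + 1)"]])
          (auto intro!: continuous_intros)
      then show ?thesis by (rule continuous_on_interior) auto
    qed
    then show ?thesis by (simp add: continuous_at_imp_continuous_on)
  qed
  have bc: "\<Phi> v \<in> bcontfun" for v
  proof (rule bcontfun_normI)
    show "continuous_on UNIV (\<Phi> v)"
      unfolding \<Phi>_def by (intro continuous_intros cont_pot)
    fix r :: real
    have "norm (radial_potential n (G v) (max 0 r)) \<le> B * exp (c * (max 0 r)\<^sup>2) / (2 * c)"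
    proof (rule norm_radial_potential_gaussian_le)
      fix t :: real
      have "B * 1 \<le> B * exp (c * t\<^sup>2)" by (rule mult_left_mono) (use c B0 in auto)
      then show "norm (G v t) \<le> B * exp (c * t\<^sup>2)" using B unfolding G_def by (metis mult_1_right order_trans)
    qed (use G c B0 in auto)
    also have "\<dots> \<le> B / (2 * c) * exp (c * r\<^sup>2)"
    proof -
      have "(max 0 r)\<^sup>2 \<le> r\<^sup>2" by (simp add: max_def)
      then have "exp (c * (max 0 r)\<^sup>2) \<le> exp (c * r\<^sup>2)" using c by simp
      then have "B / (2 * c) * exp (c * (max 0 r)\<^sup>2) \<le> B / (2 * c) * exp (c * r\<^sup>2)"
        by (rule mult_left_mono) (use c B0 in auto)
      then show ?thesis by simp
    qed
    finally have "norm (a - radial_potential n (G v) (max 0 r)) \<le> norm a + B / (2 * c) * exp (c * r\<^sup>2)"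
      using norm_triangle_ineq4[of a "radial_potential n (G v) (max 0 r)"] by linarith
    also have "\<dots> \<le> (norm a + B / (2 * c)) * exp (c * r\<^sup>2)"
    proof -
      have "norm a * 1 \<le> norm a * exp (c * r\<^sup>2)" by (rule mult_left_mono) (use c in auto)
      then show ?thesis by (simp add: distrib_right)
    qed
    finally have "exp (- (c * r\<^sup>2)) * norm (a - radial_potential n (G v) (max 0 r))
        \<le> exp (- (c * r\<^sup>2)) * ((norm a + B / (2 * c)) * exp (c * r\<^sup>2))"
      by (rule mult_left_mono) simp
    also have "\<dots> = norm a + B / (2 * c)" by (simp add: exp_minus)
    finally show "norm (\<Phi> v r) \<le> norm a + B / (2 * c)" by (simp add: \<Phi>_def)
  qed
  define \<Psi> where "\<Psi> = (\<lambda>v. Bcontfun (\<Phi> v))"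
  have \<Psi>: "apply_bcontfun (\<Psi> v) r = \<Phi> v r" for v r
    unfolding \<Psi>_def by (simp add: Bcontfun_inverse[OF bc])
  have "dist (\<Psi> v) (\<Psi> w) \<le> 1 / 2 * dist v w" for v w
  proof (rule dist_bound)
    fix r :: real
    define s where "s = max 0 r"
    have "norm (radial_potential n (\<lambda>t. G v t - G w t) s) \<le> (L * dist v w) * exp (c * s\<^sup>2) / (2 * c)"
    proof (rule norm_radial_potential_gaussian_le)
      fix t :: real
      have "norm (G v t - G w t) \<le> L * norm (exp (c * t\<^sup>2) *\<^sub>R v t - exp (c * t\<^sup>2) *\<^sub>R w t)"
        using lipschitz_onD[OF F] by (simp add: G_def dist_norm)
      also have "\<dots> = L * (exp (c * t\<^sup>2) * dist (v t) (w t))"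
        by (simp add: dist_norm flip: scaleR_diff_right)
      also have "\<dots> \<le> L * (exp (c * t\<^sup>2) * dist v w)"
        by (intro mult_left_mono dist_bounded) (use L in auto)
      finally show "norm (G v t - G w t) \<le> (L * dist v w) * exp (c * t\<^sup>2)" by (simp add: mult_ac)
    qed (use c L in \<open>auto intro!: continuous_intros G simp: s_def\<close>)
    also have "\<dots> \<le> dist v w / 2 * exp (c * r\<^sup>2)"
    proof -
      have "L * (dist v w * exp (c * s\<^sup>2)) \<le> c * (dist v w * exp (c * r\<^sup>2))"
        by (intro mult_mono) (use c L in \<open>auto simp: s_def max_def\<close>)
      then show ?thesis using c by (simp add: field_simps)
    qed
    finally have "exp (- (c * r\<^sup>2)) * norm (radial_potential n (\<lambda>t. G v t - G w t) s)
        \<le> exp (- (c * r\<^sup>2)) * (dist v w / 2 * exp (c * r\<^sup>2))"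
      by (rule mult_left_mono) simp
    also have "\<dots> = 1 / 2 * dist v w" by (simp add: exp_minus)
    finally have "exp (- (c * r\<^sup>2)) * norm (radial_potential n (\<lambda>t. G v t - G w t) s) \<le> 1 / 2 * dist v w" .
    moreover have "dist (\<Psi> v r) (\<Psi> w r) = exp (- (c * r\<^sup>2)) * norm (radial_potential n (\<lambda>t. G v t - G w t) s)"
      unfolding \<Psi> \<Phi>_def dist_norm s_def[symmetric] radial_potential_diff[OF G G]
      by (simp flip: scaleR_diff_right) (simp add: norm_minus_commute)
    ultimately show "dist (\<Psi> v r) (\<Psi> w r) \<le> 1 / 2 * dist v w" by simp
  qed
  then obtain v where v: "\<Psi> v = v"
    using banach_fix_type[of "1/2" \<Psi>] by auto
  define u where "u = (\<lambda>t. exp (c * t\<^sup>2) *\<^sub>R apply_bcontfun v t)"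
  show thesis
  proof
    show "continuous_on {0..} u" unfolding u_def by (intro continuous_intros) auto
    fix r :: real assume "r \<ge> 0"
    then have "v r = exp (- (c * r\<^sup>2)) *\<^sub>R (a - radial_potential n (G v) r)"
      using \<Psi>[of v r] v by (simp add: \<Phi>_def)
    then have "u r = a - radial_potential n (G v) r"
      by (simp add: u_def exp_minus)
    then show "u r = a - radial_potential n (\<lambda>t. F (u t)) r"
      by (simp add: G_def u_def)
  qed
qed

section \<open>Paths in the positive orthant\<close>

lemma open_pos_orthant: "open (pos_orthant :: (real ^ 'l) set)"
proof -
  have eq: "pos_orthant = (\<Inter>i. {u :: real ^ 'l. u $ i > 0})" by (auto simp: pos_orthant_def)
  have "open {u :: real ^ 'l. u $ i > 0}" for i
    by (intro open_Collect_less continuous_intros)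
  then show ?thesis unfolding eq by (intro open_INT finite ballI)
qed

lemma closure_pos_orthant: "closure pos_orthant = {u :: real ^ 'l. \<forall>i. u $ i \<ge> 0}"
proof
  have "{u :: real ^ 'l. \<forall>i. u $ i \<ge> 0} = (\<Inter>i. {u. u $ i \<ge> 0})" by auto
  moreover have "closed {u :: real ^ 'l. u $ i \<ge> 0}" for i
    by (intro closed_Collect_le continuous_intros)
  ultimately have "closed {u :: real ^ 'l. \<forall>i. u $ i \<ge> 0}" by (simp add: closed_INT)
  moreover have "pos_orthant \<subseteq> {u :: real ^ 'l. \<forall>i. u $ i \<ge> 0}"
    by (auto simp: pos_orthant_def less_imp_le)
  ultimately show "closure pos_orthant \<subseteq> {u :: real ^ 'l. \<forall>i. u $ i \<ge> 0}"
    by (rule closure_minimal[rotated])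
  show "{u :: real ^ 'l. \<forall>i. u $ i \<ge> 0} \<subseteq> closure pos_orthant"
  proof
    fix u :: "real ^ 'l" assume u: "u \<in> {u. \<forall>i. u $ i \<ge> 0}"
    show "u \<in> closure pos_orthant"
      unfolding closure_approachable
    proof (intro allI impI)
      fix e :: real assume e: "e > 0"
      define d where "d = e / (norm (1 :: real ^ 'l) + 1)"
      have d: "d > 0" using e by (simp add: d_def add_nonneg_pos)
      have "d * norm (1 :: real ^ 'l) < d * (norm (1 :: real ^ 'l) + 1)" using d by simp
      also have "\<dots> = e" unfolding d_def
        using norm_ge_zero[of "1 :: real ^ 'l"] by (simp add: add_nonneg_eq_0_iff)
      finally have "dist (u + d *\<^sub>R 1) u < e" using d by (simp add: dist_norm)
      moreover have "u + d *\<^sub>R 1 \<in> pos_orthant"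
        using u d by (auto simp: pos_orthant_def add_nonneg_pos)
      ultimately show "\<exists>y\<in>pos_orthant. dist y u < e" by blast
    qed
  qed
qed

lemma frontier_pos_orthant:
  "frontier pos_orthant = {u :: real ^ 'l. (\<forall>i. u $ i \<ge> 0) \<and> (\<exists>i. u $ i = 0)}"
proof (rule set_eqI)
  fix u :: "real ^ 'l"
  have "0 < u $ i \<longleftrightarrow> u $ i \<noteq> 0" if "0 \<le> u $ i" for i using that by linarith
  moreover have "u \<in> frontier pos_orthant \<longleftrightarrow> u \<in> closure pos_orthant \<and> u \<notin> pos_orthant"
    by (simp add: frontier_def interior_open[OF open_pos_orthant])
  ultimately show "u \<in> frontier pos_orthant \<longleftrightarrow> u \<in> {u. (\<forall>i. u $ i \<ge> 0) \<and> (\<exists>i. u $ i = 0)}"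
    unfolding closure_pos_orthant by (auto simp: pos_orthant_def)
qed

text \<open>By compactness. It places a solution on a closed interval before the exit in a compact
  part of the open orthant, where \<open>f\<close> has a Lipschitz constant.\<close>

lemma path_in_pos_orthant_lower_bound:
  fixes u :: "real \<Rightarrow> real ^ 'l"
  assumes "continuous_on {0..T} u" "T \<ge> 0" "\<And>s. s \<in> {0..T} \<Longrightarrow> u s \<in> pos_orthant"
  obtains e where "e > 0" "\<And>s i. s \<in> {0..T} \<Longrightarrow> e < u s $ i"
proof -
  have "\<exists>e>0. \<forall>s\<in>{0..T}. e < u s $ i" for i
  proof -
    have "continuous_on {0..T} (\<lambda>s. u s $ i)" by (intro continuous_intros assms)
    then obtain s where s: "s \<in> {0..T}" "\<And>t. t \<in> {0..T} \<Longrightarrow> u s $ i \<le> u t $ i"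
      using continuous_attains_inf[of "{0..T}" "\<lambda>s. u s $ i"] assms(2) by force
    have "u s $ i > 0" using assms(3)[OF s(1)] by (simp add: pos_orthant_def)
    then show ?thesis using s(2) by (intro exI[of _ "u s $ i / 2"]) (fastforce intro: less_le_trans[of _ "u s $ i"])
  qed
  then obtain e where e: "\<And>i. e i > 0" "\<And>i s. s \<in> {0..T} \<Longrightarrow> e i < u s $ i" by metis
  show thesis
  proof
    show "Min (range e) > 0" using e(1) by (subst Min_gr_iff) auto
    fix s i assume "s \<in> {0..T}"
    have "Min (range e) \<le> e i" by (rule Min_le) auto
    also have "\<dots> < u s $ i" by (rule e(2)) fact
    finally show "Min (range e) < u s $ i" .
  qed
qed

text \<open>For continuation arguments: an estimate that presupposes \<open>h \<le> c\<close> up to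
  time t is applied at the first time with \<open>h t = c\<close> and contradicts it there. That
  time is the minimum of the compact set where h \<ge> c.\<close>

lemma first_crossing:
  fixes h :: "real \<Rightarrow> real"
  assumes "continuous_on {0..m} h" "h 0 < c" "s \<in> {0..m}" "h s \<ge> c"
  obtains t where "t \<in> {0..m}" "h t = c" "\<And>x. x \<in> {0..t} \<Longrightarrow> h x \<le> c"
proof -
  define C where "C = {x \<in> {0..m}. h x \<ge> c}"
  have "closed ({0..m} \<inter> h -` {c..})"
    by (rule continuous_closed_preimage[OF assms(1)]) auto
  moreover have "C = {0..m} \<inter> h -` {c..}" by (auto simp: C_def)
  moreover have "bounded C" by (rule bounded_subset[of "{0..m}"]) (auto simp: C_def)
  ultimately have "compact C" by (simp add: compact_eq_bounded_closed)
  moreover have "s \<in> C" using assms by (simp add: C_def)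
  ultimately obtain t where t: "t \<in> C" "\<And>x. x \<in> C \<Longrightarrow> t \<le> x"
    using compact_attains_inf[of C] by blast
  have lt: "h x < c" if "x \<in> {0..<t}" for x
    using t(2)[of x] t(1) that by (force simp: C_def)
  have "continuous_on {0..t} h" by (rule continuous_on_subset[OF assms(1)]) (use t in \<open>auto simp: C_def\<close>)
  then obtain x where "0 \<le> x" "x \<le> t" "h x = c"
    using IVT'[of h 0 c t] assms(2) t(1) by (auto simp: C_def)
  then have "h t = c" using lt[of x] by (cases "x = t") auto
  then show thesis
    using that[of t] t(1) lt by (force simp: C_def less_le)
qed

section \<open>Solutions of the shooting problem\<close>

locale shooting =
  fixes f :: "real ^ 'l \<Rightarrow> real ^ 'l" and n :: nat
  assumes f_cont: "continuous_on (closure pos_orthant) f"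
    and f_lip: "locally_lipschitz_on pos_orthant f"
    and f_sum: "\<And>v. v \<in> pos_orthant \<Longrightarrow> (\<Sum>i\<in>UNIV. f v $ i) \<ge> 0"
    and f_bdry: "\<And>a :: real ^ 'l. a \<in> frontier pos_orthant \<Longrightarrow> a \<noteq> 0 \<Longrightarrow>
      \<exists>\<delta>>0. \<exists>C\<ge>0. \<forall>\<beta>\<in>pos_orthant. norm (\<beta> - a) < \<delta> \<longrightarrow>
        (\<Sum>i | a $ i > 0. \<bar>f \<beta> $ i\<bar>) \<le> C * (\<Sum>i | a $ i = 0. f \<beta> $ i)"
    and n_pos: "n > 0"
begin

text \<open>Values in the closure, where \<open>f\<close> is still continuous, let a solution be
  followed up to and including its exit point. The integral equation contains the initial value and
  the zero slope at 0, and it passes to limits.\<close>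

definition sol :: "real ^ 'l \<Rightarrow> real \<Rightarrow> (real \<Rightarrow> real ^ 'l) \<Rightarrow> bool" where
  "sol a T u \<longleftrightarrow> continuous_on {0..T} u \<and>
    (\<forall>r\<in>{0..T}. u r \<in> closure pos_orthant \<and> u r = a - radial_potential n (\<lambda>t. f (u t)) r)"

definition maximal :: "real ^ 'l \<Rightarrow> real \<Rightarrow> (real \<Rightarrow> real ^ 'l) \<Rightarrow> bool" where
  "maximal a T u \<longleftrightarrow> T > 0 \<and> sol a T u \<and> (\<forall>r\<in>{0..<T}. u r \<in> pos_orthant) \<and> u T \<in> frontier pos_orthant"

definition start :: "(real ^ 'l) set" where
  "start = {a \<in> pos_orthant. (\<Sum>i\<in>UNIV. a $ i) = 1}"

text \<open>Solutions from \<open>start\<close> stay in \<open>box_from 0\<close>, where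
  \<open>f\<close> is bounded. For e > 0 the box is a compact subset of the open orthant, where
  \<open>f\<close> is Lipschitz.\<close>

definition box_from :: "real \<Rightarrow> (real ^ 'l) set" where
  "box_from e = cbox (vec e) 1"

lemma mem_box_from: "v \<in> box_from e \<longleftrightarrow> (\<forall>i. e \<le> v $ i \<and> v $ i \<le> 1)"
  by (simp add: box_from_def mem_box_cart)

lemma solD:
  assumes "sol a T u"
  shows "continuous_on {0..T} u" "\<And>r. r \<in> {0..T} \<Longrightarrow> u r \<in> closure pos_orthant"
    "\<And>r. r \<in> {0..T} \<Longrightarrow> u r = a - radial_potential n (\<lambda>t. f (u t)) r"
    "continuous_on {0..T} (\<lambda>t. f (u t))"
proof -
  show u: "continuous_on {0..T} u" and cl: "\<And>r. r \<in> {0..T} \<Longrightarrow> u r \<in> closure pos_orthant"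
    and "\<And>r. r \<in> {0..T} \<Longrightarrow> u r = a - radial_potential n (\<lambda>t. f (u t)) r"
    using assms unfolding sol_def by blast+
  show "continuous_on {0..T} (\<lambda>t. f (u t))"
    by (rule continuous_on_compose2[OF f_cont u]) (use cl in blast)
qed

lemma sol_subinterval:
  assumes "sol a T u" "S \<le> T"
  shows "sol a S u"
proof -
  have "{0..S} \<subseteq> {0..T}" using assms(2) by auto
  then show ?thesis using assms(1) continuous_on_subset unfolding sol_def by blast
qed

lemma sol_0:
  assumes "sol a T u" "T \<ge> 0"
  shows "u 0 = a"
  using solD(3)[OF assms(1), of 0] assms(2) by simp

lemma sol_cong:
  assumes "sol a T u" "\<And>t. t \<in> {0..T} \<Longrightarrow> v t = u t"
  shows "sol a T v"
  unfolding sol_def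
proof (intro conjI ballI)
  show "continuous_on {0..T} v" using solD(1)[OF assms(1)] by (subst continuous_on_cong[OF refl assms(2)])
  fix r assume r: "r \<in> {0..T}"
  show "v r \<in> closure pos_orthant" using solD(2)[OF assms(1) r] assms(2)[OF r] by simp
  have "radial_potential n (\<lambda>t. f (v t)) r = radial_potential n (\<lambda>t. f (u t)) r"
    by (rule radial_potential_cong) (use r assms(2) in auto)
  then show "v r = a - radial_potential n (\<lambda>t. f (v t)) r"
    using solD(3)[OF assms(1) r] assms(2)[OF r] by simp
qed

lemma sol_linear:
  fixes h :: "real ^ 'l \<Rightarrow> real"
  assumes "sol a T u" "r \<in> {0..T}" "bounded_linear h"
  shows "h (u r) = h a - radial_potential n (\<lambda>t. h (f (u t))) r"
proof -
  interpret bounded_linear h by fact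
  have "continuous_on {0..r} (\<lambda>t. f (u t))"
    by (rule continuous_on_subset[OF solD(4)[OF assms(1)]]) (use assms(2) in auto)
  from radial_potential_linear[OF assms(3) this] show ?thesis
    using arg_cong[OF solD(3)[OF assms(1,2)], of h] by (simp add: diff)
qed

lemma bounded_linear_sum_components: "bounded_linear (\<lambda>v :: real ^ 'l. \<Sum>i\<in>I. v $ i)"
  by (intro bounded_linear_sum bounded_linear_vec_nth)

lemma f_sum_closure:
  assumes "v \<in> closure pos_orthant"
  shows "(\<Sum>i\<in>UNIV. f v $ i) \<ge> 0"
  by (rule continuous_ge_on_closure[OF _ assms f_sum]) (intro continuous_intros f_cont)

text \<open>Summed over all components, the right-hand side is nonnegative by \<open>f_sum\<close>,
  so its potential is too. This is the a priori bound: with nonnegative components and total at most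
  1, each component is at most 1.\<close>

lemma sol_sum_le:
  assumes "sol a T u" "r \<in> {0..T}"
  shows "(\<Sum>i\<in>UNIV. u r $ i) \<le> (\<Sum>i\<in>UNIV. a $ i)"
proof -
  have "radial_potential n (\<lambda>t. \<Sum>i\<in>UNIV. f (u t) $ i) r \<ge> 0"
  proof (rule radial_potential_nonneg)
    show "continuous_on {0..r} (\<lambda>t. \<Sum>i\<in>UNIV. f (u t) $ i)"
      by (intro continuous_intros continuous_on_subset[OF solD(4)[OF assms(1)]]) (use assms in auto)
  qed (use assms in \<open>auto intro!: f_sum_closure solD(2)[OF assms(1)]\<close>)
  then show ?thesis
    using sol_linear[OF assms bounded_linear_sum_components[of UNIV]] by simp
qed

lemma closure_component_nonneg: "v \<in> closure pos_orthant \<Longrightarrow> (v :: real ^ 'l) $ i \<ge> 0"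
  by (simp add: closure_pos_orthant)

lemma component_le_sum:
  assumes "v \<in> closure pos_orthant"
  shows "v $ i \<le> (\<Sum>i\<in>UNIV. (v :: real ^ 'l) $ i)"
  by (rule member_le_sum) (use closure_component_nonneg[OF assms] in auto)

lemma sol_component_le_1:
  assumes "sol a T u" "r \<in> {0..T}" "a \<in> start"
  shows "u r $ i \<le> 1"
  using component_le_sum[OF solD(2)[OF assms(1,2)], of i] sol_sum_le[OF assms(1,2)] assms(3)
  by (simp add: start_def)

lemma sol_in_box:
  assumes "sol a T u" "r \<in> {0..T}" "a \<in> start"
  shows "u r \<in> box_from 0"
  using sol_component_le_1[OF assms] closure_component_nonneg[OF solD(2)[OF assms(1,2)]]
  by (simp add: mem_box_from)

lemma box_from_0_subset: "box_from 0 \<subseteq> closure pos_orthant"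
  by (auto simp: mem_box_from closure_pos_orthant)

lemma box_from_pos_subset: "e > 0 \<Longrightarrow> box_from e \<subseteq> pos_orthant"
  by (auto simp: mem_box_from pos_orthant_def intro: less_le_trans)

lemma f_bounded_on_box:
  obtains B where "B > 0" "\<And>v. v \<in> box_from 0 \<Longrightarrow> norm (f v) \<le> B"
proof -
  have "bounded (f ` box_from 0)"
    by (intro compact_imp_bounded compact_continuous_image continuous_on_subset[OF f_cont] box_from_0_subset)
      (simp add: box_from_def)
  then show thesis using that unfolding bounded_pos by blast
qed

lemma f_lipschitz_on_box:
  assumes "e > 0"
  obtains L where "L-lipschitz_on (box_from e) f"
proof -
  \<comment> \<open>A time-dependent notion used with one dummy time; compactness of the box then
    yields a single constant.\<close>
  have "local_lipschitz {0::real} (box_from e) (\<lambda>_. f)"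
  proof (rule local_lipschitzI)
    fix x assume "x \<in> box_from e"
    then have "x \<in> pos_orthant" using box_from_pos_subset[OF assms] by blast
    then obtain d K where d: "d > 0" "K-lipschitz_on (cball x d \<inter> pos_orthant) f"
      using f_lip unfolding locally_lipschitz_on_def by blast
    have "K-lipschitz_on (cball x d \<inter> box_from e) f"
      by (rule lipschitz_on_subset[OF d(2)]) (use box_from_pos_subset[OF assms] in auto)
    then show "\<exists>u>0. \<exists>L. \<forall>t\<in>cball t u \<inter> {0}. L-lipschitz_on (cball x u \<inter> box_from e) f" for t :: real
      using d(1) by blast
  qed
  from local_lipschitz_compact_implies_lipschitz[OF this]
  obtain L where "\<And>t. t \<in> {0::real} \<Longrightarrow> L-lipschitz_on (box_from e) f"
    by (auto simp: box_from_def)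
  then show thesis using that by blast
qed

lemma sol_stability:
  assumes "e > 0" "L-lipschitz_on (box_from e) f" "a \<in> start" "b \<in> start" "sol a T u" "sol b T v"
    and "\<And>s i. s \<in> {0..T} \<Longrightarrow> e \<le> u s $ i" "\<And>s i. s \<in> {0..T} \<Longrightarrow> e \<le> v s $ i"
    and "r \<in> {0..T}"
  shows "norm (u r - v r) \<le> 2 * norm (a - b) * exp ((L + 1) * r\<^sup>2)"
  by (rule radial_equation_stability[OF solD(1)[OF assms(5)] solD(1)[OF assms(6)] assms(2) _ _
        solD(3)[OF assms(5)] solD(3)[OF assms(6)] assms(9)])
    (simp_all add: mem_box_from assms(7,8) sol_component_le_1[OF assms(5) _ assms(3)]
      sol_component_le_1[OF assms(6) _ assms(4)] del: atLeastAtMost_iff)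

lemma sol_unique:
  assumes "a \<in> start" "sol a T u" "sol a T v" "r \<in> {0..T}"
    and "\<And>s. s \<in> {0..T} \<Longrightarrow> u s \<in> pos_orthant" "\<And>s. s \<in> {0..T} \<Longrightarrow> v s \<in> pos_orthant"
  shows "u r = v r"
proof -
  have T: "T \<ge> 0" using assms(4) by simp
  obtain e where e: "e > 0" "\<And>s i. s \<in> {0..T} \<Longrightarrow> e < u s $ i"
    using path_in_pos_orthant_lower_bound[OF solD(1)[OF assms(2)] T assms(5)] by blast
  obtain d where d: "d > 0" "\<And>s i. s \<in> {0..T} \<Longrightarrow> d < v s $ i"
    using path_in_pos_orthant_lower_bound[OF solD(1)[OF assms(3)] T assms(6)] by blast
  have m: "min e d > 0" using e d by simp
  obtain L where L: "L-lipschitz_on (box_from (min e d)) f" by (rule f_lipschitz_on_box[OF m])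
  have "norm (u r - v r) \<le> 2 * norm (a - a) * exp ((L + 1) * r\<^sup>2)"
    by (rule sol_stability[OF m L assms(1,1,2,3) _ _ assms(4)]) (simp_all add: min.coboundedI1 min.coboundedI2 less_imp_le e(2) d(2) del: atLeastAtMost_iff)
  then show ?thesis by simp
qed

text \<open>Composing \<open>f\<close> with the projection K onto a compact box gives a bounded,
  globally Lipschitz field, whose solution w exists for all r. By stability w equals u up to r, and
  it remains in the box, where the two fields agree, a little beyond r.\<close>

lemma sol_extend:
  assumes a: "a \<in> start" and u: "sol a r u" and r: "r \<ge> 0"
    and pos: "\<And>s. s \<in> {0..r} \<Longrightarrow> u s \<in> pos_orthant"
  shows "\<exists>R v. R > r \<and> sol a R v \<and> (\<forall>s\<in>{0..R}. v s \<in> pos_orthant)"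
proof -
  obtain e where e: "e > 0" "\<And>s i. s \<in> {0..r} \<Longrightarrow> e < u s $ i"
    using path_in_pos_orthant_lower_bound[OF solD(1)[OF u] r pos] by blast
  have e1: "e \<le> 1"
    using e(2)[of 0] sol_component_le_1[OF u _ a, of 0] r by (force intro: less_imp_le less_le_trans)
  obtain L where L: "L-lipschitz_on (box_from e) f" by (rule f_lipschitz_on_box[OF e(1)])
  obtain B where B: "\<And>v. v \<in> box_from 0 \<Longrightarrow> norm (f v) \<le> B" by (rule f_bounded_on_box) blast
  define K where "K = (clamp (vec e) 1 :: real ^ 'l \<Rightarrow> real ^ 'l)"
  have K: "K v \<in> box_from e" for v
    unfolding K_def box_from_def
    by (rule clamp_in_interval) (use e1 in \<open>auto simp: Basis_vec_def inner_axis\<close>)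
  have K_id: "K v = v" if "v \<in> box_from e" for v
    unfolding K_def by (rule clamp_cancel_cbox) (use that in \<open>simp add: box_from_def\<close>)
  have box0: "box_from e \<subseteq> box_from 0" using e(1) by (fastforce simp: mem_box_from intro: order_trans[of 0 e])
  define F where "F = (\<lambda>v. f (K v))"
  have F: "L-lipschitz_on UNIV F"
  proof (rule lipschitz_onI)
    fix x y
    have "dist (f (K x)) (f (K y)) \<le> L * dist (K x) (K y)" by (rule lipschitz_onD[OF L K K])
    also have "\<dots> \<le> L * dist x y"
      unfolding K_def by (rule mult_left_mono[OF dist_clamps_le_dist_args lipschitz_on_nonneg[OF L]])
    finally show "dist (F x) (F y) \<le> L * dist x y" by (simp add: F_def)
  qed (rule lipschitz_on_nonneg[OF L])
  have "norm (F v) \<le> B" for v using B K box0 unfolding F_def by blast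
  then obtain w where w: "continuous_on {0..} w"
    "\<And>r. r \<ge> 0 \<Longrightarrow> w r = a - radial_potential n (\<lambda>t. F (w t)) r"
    using radial_equation_global_solution[OF F] by metis
  have w_cont: "continuous_on {0..t} w" for t by (rule continuous_on_subset[OF w(1)]) auto
  have Fw_cont: "continuous_on {0..t} (\<lambda>s. F (w s))" for t
    by (rule continuous_on_compose2[OF lipschitz_on_continuous_on[OF F] w_cont]) auto
  have u_box: "u s \<in> box_from e" if "s \<in> {0..r}" for s
    using e(2)[OF that] sol_component_le_1[OF u that a] by (auto simp: mem_box_from less_imp_le)
  have uw: "w s = u s" if s: "s \<in> {0..r}" for s
  proof -
    have "norm (w s - u s) \<le> 2 * norm (a - a) * exp ((L + 1) * s\<^sup>2)"
    proof (rule radial_equation_stability[OF w_cont solD(1)[OF u] F _ _ _ _ s])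
      fix t assume t: "t \<in> {0..r}"
      have "radial_potential n (\<lambda>s. F (u s)) t = radial_potential n (\<lambda>s. f (u s)) t"
        by (rule radial_potential_cong) (use t u_box K_id in \<open>auto simp: F_def\<close>)
      then show "u t = a - radial_potential n (\<lambda>s. F (u s)) t"
        using solD(3)[OF u t] by simp
    qed (use w(2) in auto)
    then show ?thesis by simp
  qed
  define U where "U = (\<Inter>i. {v :: real ^ 'l. e < v $ i})"
  have "open U"
    unfolding U_def by (intro open_INT ballI finite open_Collect_less continuous_intros)
  moreover have "w r \<in> U" using uw[of r] e(2)[of r] r by (simp add: U_def)
  ultimately obtain d where d: "d > 0" "ball (w r) d \<subseteq> U" by (rule openE)
  obtain h where h: "h > 0" "\<And>s. s \<ge> 0 \<Longrightarrow> dist s r < h \<Longrightarrow> dist (w s) (w r) < d"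
    using w(1) d(1) r unfolding continuous_on_iff by (metis atLeast_iff)
  define R where "R = r + h / 2"
  have wU: "e < w s $ i" if "s \<in> {0..R}" for s i
  proof (cases "s \<le> r")
    case True
    then show ?thesis using e(2)[of s i] uw[of s] that by simp
  next
    case False
    then have "dist (w s) (w r) < d" using h that by (intro h(2)) (auto simp: R_def dist_real_def)
    then have "w s \<in> U" using d(2) by (auto simp: dist_commute)
    then show ?thesis by (simp add: U_def)
  qed
  \<comment> \<open>The lower bounds persist beyond r by continuity, being strict. The upper bound 1
    may be attained, so it is recovered from the sum instead: K takes values in the orthant, hence
    the components of F also have a nonnegative sum.\<close>
  have w_sum: "(\<Sum>i\<in>UNIV. w s $ i) \<le> 1" if "s \<in> {0..R}" for s
  proof -
    have "radial_potential n (\<lambda>t. \<Sum>i\<in>UNIV. F (w t) $ i) s \<ge> 0"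
    proof (rule radial_potential_nonneg)
      show "continuous_on {0..s} (\<lambda>t. \<Sum>i\<in>UNIV. F (w t) $ i)"
        by (intro continuous_intros Fw_cont)
      show "0 \<le> (\<Sum>i\<in>UNIV. F (w t) $ i)" for t
        using f_sum box_from_pos_subset[OF e(1)] K unfolding F_def by blast
    qed
    then show ?thesis
      using radial_potential_linear[OF bounded_linear_sum_components[of UNIV] Fw_cont, of n s]
        w(2)[of s] that a by (simp add: start_def sum_subtractf)
  qed
  have w_cl: "w s \<in> closure pos_orthant" "w s \<in> pos_orthant" if "s \<in> {0..R}" for s
  proof -
    show "w s \<in> pos_orthant"
      using wU[OF that] e(1) by (auto simp: pos_orthant_def intro: less_trans)
    then show "w s \<in> closure pos_orthant" using closure_subset by blast
  qed
  have "w s \<in> box_from e" if "s \<in> {0..R}" for s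
    using wU[OF that] order_trans[OF component_le_sum[OF w_cl(1)[OF that]] w_sum[OF that]]
    by (auto simp: mem_box_from less_imp_le)
  then have Fw: "F (w s) = f (w s)" if "s \<in> {0..R}" for s
    using K_id that by (simp add: F_def)
  have "sol a R w"
    unfolding sol_def
  proof (intro conjI ballI w_cl(1) w_cont)
    fix s assume s: "s \<in> {0..R}"
    have "radial_potential n (\<lambda>t. F (w t)) s = radial_potential n (\<lambda>t. f (w t)) s"
      by (rule radial_potential_cong) (use s Fw in auto)
    then show "w s = a - radial_potential n (\<lambda>t. f (w t)) s" using w(2)[of s] s by simp
  qed
  moreover have "R > r" using h by (simp add: R_def)
  ultimately show ?thesis using w_cl(2) by blast
qed

section \<open>Continuation up to the exit from the orthant\<close>

lemma sol_lipschitz: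
  assumes "a \<in> start" "sol a T u" "\<And>v. v \<in> box_from 0 \<Longrightarrow> norm (f v) \<le> B"
    and "x \<in> {0..T}" "y \<in> {0..T}"
  shows "norm (u x - u y) \<le> B * T * \<bar>x - y\<bar>"
proof -
  have "norm (radial_potential n (\<lambda>t. f (u t)) x - radial_potential n (\<lambda>t. f (u t)) y) \<le> B * T * \<bar>x - y\<bar>"
    by (rule norm_radial_potential_diff_le[OF solD(4)[OF assms(2)] _ assms(4,5)])
      (use assms sol_in_box in blast)
  then show ?thesis
    using solD(3)[OF assms(2,4)] solD(3)[OF assms(2,5)] by (simp add: norm_minus_commute)
qed

lemma global_or_maximal:
  assumes a: "a \<in> start"
  shows "(\<exists>u. \<forall>T\<ge>0. sol a T u \<and> u T \<in> pos_orthant) \<or> (\<exists>T u. maximal a T u)"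
proof -
  define good where "good = (\<lambda>T v. T \<ge> 0 \<and> sol a T v \<and> (\<forall>s\<in>{0..T}. v s \<in> pos_orthant))"
  define G where "G = {T. \<exists>v. good T v}"
  \<comment> \<open>For each admissible T a solution is chosen arbitrarily. By uniqueness inside the
    orthant these choices agree on common intervals, so the diagonal U glues them into one
    function.\<close>
  define V where "V = (\<lambda>T. SOME v. good T v)"
  define U where "U = (\<lambda>T. V T T)"
  have V: "good T (V T)" if "T \<in> G" for T
    using that someI_ex[of "good T"] unfolding G_def V_def by blast
  have down: "good S v" if "good T v" "0 \<le> S" "S \<le> T" for S T v
    using that sol_subinterval unfolding good_def by auto
  have G_down: "S \<in> G" if "T \<in> G" "0 \<le> S" "S \<le> T" for S T
    using that down unfolding G_def by blast
  have UV: "U s = V T s" if "T \<in> G" "s \<in> {0..T}" for s T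
  proof -
    have "good s (V s)" "good s (V T)"
      using V G_down[OF that(1)] down[OF V[OF that(1)]] that(2) by auto
    then show ?thesis
      unfolding U_def good_def using sol_unique[OF a, of s "V s" "V T" s] by auto
  qed
  have U_good: "good T U" if "T \<in> G" for T
    using V[OF that] sol_cong[of a T "V T" U] UV[OF that] unfolding good_def by auto
  have extend: "\<exists>R>T. R \<in> G" if "good T v" for T v
  proof -
    from that have v: "0 \<le> T" "sol a T v" "\<And>s. s \<in> {0..T} \<Longrightarrow> v s \<in> pos_orthant"
      unfolding good_def by auto
    obtain R w where w: "R > T" "sol a R w" "\<forall>s\<in>{0..R}. w s \<in> pos_orthant"
      using sol_extend[OF a v(2,1,3)] by blast
    then have "good R w" using that unfolding good_def by auto
    then show ?thesis using w(1) unfolding G_def by blast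
  qed
  have "good 0 (\<lambda>_. a)"
    using a closure_subset[of "pos_orthant :: (real ^ 'l) set"]
    unfolding good_def sol_def start_def by auto
  then have G0: "0 \<in> G" unfolding G_def by blast
  show ?thesis
  proof (cases "bdd_above G")
    case False
    have "T \<in> G" if "T \<ge> 0" for T
    proof -
      obtain S where "S \<in> G" "T \<le> S" using False unfolding bdd_above_def by (meson less_imp_le not_le)
      then show ?thesis using G_down that by blast
    qed
    then have "\<forall>T\<ge>0. sol a T U \<and> U T \<in> pos_orthant"
      using U_good unfolding good_def by (metis atLeastAtMost_iff order_refl)
    then show ?thesis by blast
  next
    case True
    define T where "T = Sup G"
    have ltT: "s \<in> G" if "0 \<le> s" "s < T" for s
      using less_cSupD[of G s] that G0 G_down unfolding T_def by (metis empty_iff less_imp_le)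
    have leT: "s \<le> T" if "s \<in> G" for s
      using that True unfolding T_def by (rule cSup_upper)
    obtain T' where T': "T' > 0" "T' \<in> G" using U_good[OF G0] extend by blast
    have T0: "T > 0" using T' leT by force
    obtain B where B: "B > 0" "\<And>v. v \<in> box_from 0 \<Longrightarrow> norm (f v) \<le> B" by (rule f_bounded_on_box) blast
    \<comment> \<open>The Lipschitz constant is uniform in the right endpoint because
      \<open>f\<close> is bounded on the box; hence U has a limit at the supremum T.\<close>
    have "(B * T)-lipschitz_on {0..<T} U"
    proof (rule lipschitz_onI)
      fix x y assume xy: "x \<in> {0..<T}" "y \<in> {0..<T}"
      define S where "S = max x y"
      have S: "S \<in> G" "S \<le> T" using ltT[of S] xy by (auto simp: S_def)
      have "norm (U x - U y) \<le> B * S * \<bar>x - y\<bar>"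
        by (rule sol_lipschitz[OF a _ B(2)]) (use U_good[OF S(1)] xy in \<open>auto simp: S_def good_def\<close>)
      also have "\<dots> \<le> B * T * \<bar>x - y\<bar>"
        by (intro mult_right_mono mult_left_mono S) (use B in auto)
      finally show "dist (U x) (U y) \<le> B * T * dist x y" by (simp add: dist_norm)
    qed (use B T0 in auto)
    from lipschitz_extend_closure[OF this] obtain u where
      u: "(B * T)-lipschitz_on (closure {0..<T}) u" "\<And>x. x \<in> {0..<T} \<Longrightarrow> u x = U x" by blast
    have cl: "closure {0..<T} = {0..T}" using T0 by simp
    have u_cont: "continuous_on {0..T} u" using lipschitz_on_continuous_on[OF u(1)] cl by simp
    have u_pos: "u s \<in> pos_orthant" if "s \<in> {0..<T}" for s
      using U_good[OF ltT, of s] u(2)[OF that] that unfolding good_def by (metis atLeastAtMost_iff atLeastLessThan_iff order_refl)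
    have u_cl: "u s \<in> closure pos_orthant" if "s \<in> {0..T}" for s
    proof -
      have "u ` closure {0..<T} \<subseteq> closure (pos_orthant)"
        by (rule image_closure_subset) (use u_cont cl subsetD[OF closure_subset u_pos] in auto)
      then show ?thesis using that cl by auto
    qed
    have fu: "continuous_on {0..T} (\<lambda>t. f (u t))"
      by (rule continuous_on_compose2[OF f_cont u_cont]) (use u_cl in blast)
    have eq: "u r = a - radial_potential n (\<lambda>t. f (u t)) r" if "r \<in> {0..T}" for r
    proof -
      \<comment> \<open>The defect of the equation is continuous on the closed interval and vanishes
        on the half-open one, hence also at T.\<close>
      define h where "h = (\<lambda>r. u r - (a - radial_potential n (\<lambda>t. f (u t)) r))"
      have "h r = 0"
      proof (rule continuous_constant_on_closure[of "{0..<T}" h])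
        show "continuous_on (closure {0..<T}) h"
          unfolding h_def cl by (intro continuous_intros u_cont continuous_on_radial_potential fu)
        fix s assume s: "s \<in> {0..<T}"
        then have "sol a s U" using U_good[OF ltT] unfolding good_def by auto
        then have "sol a s u" by (rule sol_cong) (use s u(2) in auto)
        from solD(3)[OF this, of s] show "h s = 0" using s by (simp add: h_def)
      qed (use that cl in auto)
      then show ?thesis by (simp add: h_def)
    qed
    have sol: "sol a T u" unfolding sol_def using u_cont u_cl eq by blast
    have "u T \<notin> pos_orthant"
    proof
      assume "u T \<in> pos_orthant"
      then have "u s \<in> pos_orthant" if "s \<in> {0..T}" for s
        using u_pos[of s] that by (cases "s = T") auto
      then have "good T u"
        unfolding good_def using sol T0 by auto
      then show False using extend leT by (meson not_le)
    qed
    then have "u T \<in> frontier pos_orthant"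
      using u_cl[of T] T0 by (simp add: frontier_def interior_open[OF open_pos_orthant])
    then have "maximal a T u"
      unfolding maximal_def using sol T0 u_pos by blast
    then show ?thesis by blast
  qed
qed

end

section \<open>Continuity of the target map\<close>

lemma exists_near_left:
  fixes x T K q :: real
  assumes "x < T" "K \<ge> 0" "q > 0"
  obtains r where "x < r" "r < T" "K * (T - r) < q"
proof
  define r where "r = max ((x + T) / 2) (T - q / (2 * (K + 1)))"
  have p: "q / (2 * (K + 1)) > 0" using assms by simp
  show "x < r" using assms(1) by (simp add: r_def less_max_iff_disj)
  show "r < T" using assms(1) p by (simp add: r_def)
  have "K * (T - r) \<le> K * (q / (2 * (K + 1)))"
    by (rule mult_left_mono) (use assms in \<open>auto simp: r_def\<close>)
  also have "\<dots> < q"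
  proof -
    have "0 \<le> K * q" using assms by simp
    then have "K * q < q * (2 * (K + 1))" using assms(3) by (simp add: algebra_simps)
    then show ?thesis using assms(2) by (simp add: pos_divide_less_eq)
  qed
  finally show "K * (T - r) < q" .
qed

lemma abs_sum_components_diff_le:
  fixes v w :: "real ^ 'l"
  shows "\<bar>(\<Sum>i\<in>I. v $ i) - (\<Sum>i\<in>I. w $ i)\<bar> \<le> CARD('l) * norm (v - w)"
proof -
  have "\<bar>(\<Sum>i\<in>I. v $ i) - (\<Sum>i\<in>I. w $ i)\<bar> = \<bar>\<Sum>i\<in>I. (v - w) $ i\<bar>"
    by (simp add: sum_subtractf)
  also have "\<dots> \<le> (\<Sum>i\<in>I. norm (v - w))"
    by (intro order_trans[OF sum_abs] sum_mono component_le_norm_cart)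
  also have "\<dots> \<le> (\<Sum>i\<in>(UNIV :: 'l set). norm (v - w))"
    by (rule sum_mono2) auto
  finally show ?thesis by simp
qed

context shooting
begin

text \<open>Inside the orthant let s be the sum of \<open>f\<close> over the vanishing components of
  a and A the sum of absolute values over the others. Then 0 \<le> s + A \<le> (1 + C) s by
  \<open>f_sum\<close>, which settles the sign of s even for C = 0. Continuity carries the
  inequalities to the closure, which contains the exit point of a solution; passing to C + 1 makes
  the constant positive.\<close>

lemma f_bdry_closure:
  assumes a: "a \<in> frontier pos_orthant" "a \<noteq> 0"
  obtains \<delta> C where "\<delta> > 0" "C > 0"
    "\<And>v. v \<in> closure pos_orthant \<Longrightarrow> norm (v - a) < \<delta> \<Longrightarrow> 0 \<le> (\<Sum>i | a $ i = 0. f v $ i)"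
    "\<And>v j. v \<in> closure pos_orthant \<Longrightarrow> norm (v - a) < \<delta> \<Longrightarrow> a $ j > 0 \<Longrightarrow>
      \<bar>f v $ j\<bar> \<le> C * (\<Sum>i | a $ i = 0. f v $ i)"
proof -
  obtain \<delta> C where \<delta>: "\<delta> > 0" and C: "C \<ge> 0"
    and b: "\<And>v. v \<in> pos_orthant \<Longrightarrow> norm (v - a) < \<delta> \<Longrightarrow>
      (\<Sum>i | a $ i > 0. \<bar>f v $ i\<bar>) \<le> C * (\<Sum>i | a $ i = 0. f v $ i)"
    using f_bdry[OF a] by metis
  define s where "s = (\<lambda>v. \<Sum>i | a $ i = 0. f v $ i)"
  define A where "A = (\<lambda>v. \<Sum>i | a $ i > 0. \<bar>f v $ i\<bar>)"
  define W where "W = ball a \<delta> \<inter> pos_orthant"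
  have UN: "UNIV = {i. a $ i = 0} \<union> {i. a $ i > 0}"
    using a(1) by (auto simp: frontier_pos_orthant less_le)
  have AC: "A v \<le> C * s v" if "v \<in> W" for v
    using b[of v] that by (simp add: W_def A_def s_def dist_norm norm_minus_commute)
  have s0: "0 \<le> s v" if v: "v \<in> W" for v
  proof -
    have "0 \<le> (\<Sum>i\<in>UNIV. f v $ i)" using f_sum v by (simp add: W_def)
    also have "\<dots> = s v + (\<Sum>i | a $ i > 0. f v $ i)"
      unfolding UN s_def by (rule sum.union_disjoint) auto
    also have "(\<Sum>i | a $ i > 0. f v $ i) \<le> A v"
      unfolding A_def by (rule sum_mono) simp
    finally have "0 \<le> (1 + C) * s v" using AC[OF v] by (simp add: algebra_simps)
    then show ?thesis using C by (simp add: zero_le_mult_iff)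
  qed
  have fC: "\<bar>f v $ j\<bar> \<le> (C + 1) * s v" if v: "v \<in> W" and j: "a $ j > 0" for v j
  proof -
    have "\<bar>f v $ j\<bar> \<le> A v"
      unfolding A_def by (rule member_le_sum) (use j in auto)
    then show ?thesis using AC[OF v] s0[OF v] by (simp add: distrib_right)
  qed
  have cW: "v \<in> closure W" if "v \<in> closure pos_orthant" "norm (v - a) < \<delta>" for v
    using open_Int_closure_subset[of "ball a \<delta>" pos_orthant] that
    by (auto simp: W_def dist_norm norm_minus_commute)
  have fW: "continuous_on (closure W) f"
    by (rule continuous_on_subset[OF f_cont closure_mono]) (auto simp: W_def)
  show thesis
  proof (rule that[of \<delta> "C + 1"])
    fix v assume v: "v \<in> closure pos_orthant" "norm (v - a) < \<delta>"
    show "0 \<le> (\<Sum>i | a $ i = 0. f v $ i)"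
      by (rule continuous_ge_on_closure[OF _ cW[OF v]])
        (use s0 in \<open>auto intro!: continuous_intros fW simp: s_def\<close>)
    fix j assume j: "a $ j > 0"
    have "0 \<le> (C + 1) * (\<Sum>i | a $ i = 0. f v $ i) - \<bar>f v $ j\<bar>"
      by (rule continuous_ge_on_closure[OF _ cW[OF v]])
        (use fC[OF _ j] in \<open>auto intro!: continuous_intros fW simp: s_def\<close>)
    then show "\<bar>f v $ j\<bar> \<le> (C + 1) * (\<Sum>i | a $ i = 0. f v $ i)" by simp
  qed (use \<delta> C in auto)
qed

lemma maximalD:
  assumes "maximal a T u"
  shows "T > 0" "sol a T u" "\<And>r. 0 \<le> r \<Longrightarrow> r < T \<Longrightarrow> u r \<in> pos_orthant" "u T \<in> frontier pos_orthant"
  using assms by (auto simp: maximal_def)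

text \<open>On \<open>{0..r}\<close> the solution u keeps a positive distance from the boundary, so
  nearby solutions remain where \<open>f\<close> is Lipschitz and stability applies. In particular
  they cannot leave the orthant by time r.\<close>

lemma maximal_approx:
  assumes a: "a \<in> start" and u: "maximal a T u" and r: "0 \<le> r" "r < T" and \<eta>: "\<eta> > 0"
  shows "\<exists>d>0. \<forall>b\<in>start. \<forall>S v. norm (b - a) < d \<longrightarrow> maximal b S v \<longrightarrow>
    r < S \<and> (\<forall>s\<in>{0..r}. norm (v s - u s) < \<eta>)"
proof -
  have ur: "sol a r u" using sol_subinterval[OF maximalD(2)[OF u]] r by simp
  obtain e where e: "e > 0" "\<And>s i. s \<in> {0..r} \<Longrightarrow> e < u s $ i"
    using path_in_pos_orthant_lower_bound[OF solD(1)[OF ur] r(1)] maximalD(3)[OF u] r by auto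
  obtain L where L: "L-lipschitz_on (box_from (e / 2)) f" using f_lipschitz_on_box[of "e / 2"] e(1) by auto
  have L0: "L \<ge> 0" using L by (rule lipschitz_on_nonneg)
  \<comment> \<open>A path within c of u keeps all components above \<open>e / 2\<close>, the region
    in which L is valid. The radius d is then chosen so that the stability bound at r is c.\<close>
  define c where "c = min \<eta> (e / 2)"
  have c: "c > 0" using \<eta> e by (simp add: c_def)
  define d where "d = c / (2 * exp ((L + 1) * r\<^sup>2))"
  have d: "d > 0" using c by (simp add: d_def)
  have "d \<le> c / 2"
  proof -
    have "exp ((L + 1) * r\<^sup>2) \<ge> 1" using L0 by simp
    then show ?thesis using c unfolding d_def by (intro divide_left_mono) auto
  qed
  then have dc: "d < c" using c by simp
  show ?thesis
  proof (rule exI[of _ d], rule conjI[OF d], rule ballI, rule allI, rule allI, rule impI, rule impI)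
    fix b S v assume b: "b \<in> start" "norm (b - a) < d" and v: "maximal b S v"
    \<comment> \<open>It is not yet known that v exists up to r, so the comparison runs on the
      common interval. Closeness there excludes S \<le> r, since a component of \<open>v S\<close>
      vanishes.\<close>
    define m where "m = min r S"
    have m: "0 \<le> m" "m \<le> r" "m \<le> S" using r maximalD(1)[OF v] by (auto simp: m_def)
    have vm: "sol b m v" using sol_subinterval[OF maximalD(2)[OF v] m(3)] .
    have um: "sol a m u" using sol_subinterval[OF ur m(2)] .
    have low: "e / 2 \<le> v x $ i" if "norm (v x - u x) \<le> c" "x \<in> {0..m}" for x i
    proof -
      have "\<bar>(v x - u x) $ i\<bar> \<le> e / 2"
        using component_le_norm_cart[of "v x - u x" i] that(1) by (simp add: c_def)
      then have "u x $ i - e / 2 \<le> v x $ i" unfolding vector_minus_component abs_le_iff by linarith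
      then show ?thesis using e(2)[of x i] that(2) m by auto
    qed
    have close: "norm (v s - u s) < c" if s: "s \<in> {0..m}" for s
    proof (rule ccontr)
      assume neg: "\<not> ?thesis"
      define h where "h = (\<lambda>s. norm (v s - u s))"
      have "continuous_on {0..m} h"
        unfolding h_def by (intro continuous_intros solD(1)[OF vm] solD(1)[OF um])
      moreover have "h 0 < c"
        using sol_0[OF vm m(1)] sol_0[OF um m(1)] b dc by (simp add: h_def)
      moreover have "h s \<ge> c" using neg by (simp add: h_def)
      ultimately obtain t where t: "t \<in> {0..m}" "h t = c" "\<And>x. x \<in> {0..t} \<Longrightarrow> h x \<le> c"
        using first_crossing[of m h c s] s by blast
      have "norm (v t - u t) \<le> 2 * norm (b - a) * exp ((L + 1) * t\<^sup>2)"
      proof (rule sol_stability[OF _ L b(1) a sol_subinterval[OF vm] sol_subinterval[OF um]])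
        fix x i assume x: "x \<in> {0..t}"
        show "e / 2 \<le> v x $ i" by (rule low) (use t(1) t(3)[OF x] x in \<open>auto simp: h_def\<close>)
        show "e / 2 \<le> u x $ i" using e(2)[of x i] e(1) x t(1) m by auto
      qed (use e t in auto)
      also have "\<dots> \<le> 2 * norm (b - a) * exp ((L + 1) * r\<^sup>2)"
        using t(1) m L0 by (intro mult_left_mono) (auto intro!: mult_left_mono power_mono)
      also have "\<dots> < 2 * d * exp ((L + 1) * r\<^sup>2)" using b(2) by simp
      also have "\<dots> = c" by (simp add: d_def)
      finally show False using t(2) by (simp add: h_def)
    qed
    have rS: "r < S"
    proof (rule ccontr)
      assume "\<not> r < S"
      then have mS: "m = S" by (simp add: m_def)
      obtain i where "v S $ i = 0" using maximalD(4)[OF v] by (auto simp: frontier_pos_orthant)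
      then show False using low[of S i] close[of S] m mS e(1) by auto
    qed
    then have "m = r" by (simp add: m_def)
    then show "r < S \<and> (\<forall>s\<in>{0..r}. norm (v s - u s) < \<eta>)"
      using rS close by (fastforce simp: c_def)
  qed
qed

text \<open>Transversality: once the sum of the components vanishing at the exit point is strictly
  decreasing, it keeps decreasing at a definite rate, also for nearby initial values, so these
  leave the orthant soon and close by.\<close>

lemma target_continuous_interior:
  assumes a: "a \<in> start" and u: "maximal a T u" and uT: "u T \<noteq> 0" and \<epsilon>: "\<epsilon> > 0"
  shows "\<exists>d>0. \<forall>b\<in>start. \<forall>S v. norm (b - a) < d \<longrightarrow> maximal b S v \<longrightarrow> norm (v S - u T) < \<epsilon>"
proof -
  define p where "p = u T"
  define I where "I = {i. p $ i = 0}"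
  define w where "w = (\<lambda>v :: real ^ 'l. \<Sum>i\<in>I. v $ i)"
  define N where "N = real CARD('l)"
  have N: "N \<ge> 1" by (simp add: N_def)
  have w_diff: "\<bar>w v - w v'\<bar> \<le> N * norm (v - v')" for v v'
    unfolding w_def N_def by (rule abs_sum_components_diff_le)
  have w_lin: "bounded_linear w" unfolding w_def by (rule bounded_linear_sum_components)
  have T: "T > 0" and solu: "sol a T u" and upos: "\<And>r. 0 \<le> r \<Longrightarrow> r < T \<Longrightarrow> u r \<in> pos_orthant"
    and pF: "p \<in> frontier pos_orthant"
    using maximalD[OF u] by (auto simp: p_def)
  have Ine: "I \<noteq> {}" using pF by (auto simp: I_def frontier_pos_orthant)
  have wp: "w p = 0" by (simp add: w_def I_def)
  obtain \<delta> C where \<delta>: "\<delta> > 0"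
    and bdry: "\<And>v. v \<in> closure pos_orthant \<Longrightarrow> norm (v - p) < \<delta> \<Longrightarrow> 0 \<le> (\<Sum>i | p $ i = 0. f v $ i)"
    using f_bdry_closure[OF pF] uT unfolding p_def by metis
  obtain B where B: "B > 0" "\<And>v. v \<in> box_from 0 \<Longrightarrow> norm (f v) \<le> B" by (rule f_bounded_on_box) blast
  define R where "R = T + 1"
  define \<Lambda> where "\<Lambda> = B * R"
  have \<Lambda>: "\<Lambda> > 0" using B T by (simp add: \<Lambda>_def R_def)
  have lip: "norm (v x - v y) \<le> \<Lambda> * \<bar>x - y\<bar>"
    if "b \<in> start" "sol b S v" "S \<le> R" "x \<in> {0..S}" "y \<in> {0..S}" for b S v x y
  proof -
    have "norm (v x - v y) \<le> B * S * \<bar>x - y\<bar>"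
      by (rule sol_lipschitz[OF that(1,2) B(2) that(4,5)])
    also have "\<dots> \<le> \<Lambda> * \<bar>x - y\<bar>"
      unfolding \<Lambda>_def by (intro mult_right_mono mult_left_mono that(3)) (use B in auto)
    finally show ?thesis .
  qed
  have tri: "norm (x - z) \<le> norm (x - y) + norm (y - z)" for x y z :: "real ^ 'l"
    using norm_triangle_ineq[of "x - y" "y - z"] by simp
  have up: "norm (u x - p) \<le> \<Lambda> * (T - x)" if "0 \<le> x" "x \<le> T" for x
    using lip[OF a solu, of x T] that by (simp add: p_def R_def)
  define e where "e = min \<epsilon> \<delta>"
  have e: "e > 0" using \<epsilon> \<delta> by (simp add: e_def)
  \<comment> \<open>From r1 until T the solution u stays within \<delta>/2 of p, where the boundary
    condition gives the sign of the force on w.\<close>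
  obtain r1 where r1: "0 < r1" "r1 < T" "\<Lambda> * (T - r1) < \<delta> / 2"
    using exists_near_left[of 0 T \<Lambda> "\<delta> / 2"] T \<Lambda> \<delta> by auto
  define w1 where "w1 = w (u r1)"
  have w1: "w1 > 0"
    unfolding w1_def w_def using upos[of r1] r1 Ine
    by (intro sum_pos) (auto simp: pos_orthant_def)
  \<comment> \<open>A rate of decrease of w: between r1 and r3 it drops by at least
    \<open>w1 / 4\<close>, T bounds the length of that interval, and R bounds the later time Q. The
    rate does not involve r3, so r3 can be chosen afterwards.\<close>
  define c where "c = w1 / 4 / T * (r1 / R) ^ (n - 1)"
  have c: "c > 0" using w1 T r1 by (simp add: c_def R_def)
  define \<tau> where "\<tau> = min 1 (e / (4 * \<Lambda>))"
  have \<tau>: "\<tau> > 0" "\<tau> \<le> 1" "\<Lambda> * \<tau> \<le> e / 4"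
  proof -
    show "\<tau> > 0" "\<tau> \<le> 1" using e \<Lambda> by (auto simp: \<tau>_def)
    have "\<Lambda> * \<tau> \<le> \<Lambda> * (e / (4 * \<Lambda>))" by (rule mult_left_mono) (use \<Lambda> in \<open>auto simp: \<tau>_def\<close>)
    then show "\<Lambda> * \<tau> \<le> e / 4" using \<Lambda> by simp
  qed
  \<comment> \<open>The tolerance for w. At r3 the sum w of v is below 2 \<kappa>, whereas surviving
    for a further time \<tau> would lower it by at least c \<tau> \<ge> 2 \<kappa>, hence below 0.
    The bound \<tau> itself keeps the displacement after r3 below e/4.\<close>
  define \<kappa> where "\<kappa> = min (w1 / 4) (c * \<tau> / 2)"
  have \<kappa>: "\<kappa> > 0" "\<kappa> \<le> w1 / 4" "2 * \<kappa> \<le> c * \<tau>" using w1 c \<tau> by (auto simp: \<kappa>_def)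
  obtain r3 where r3: "r1 < r3" "r3 < T" "N * \<Lambda> * (T - r3) < min \<kappa> (e / 4)"
    using exists_near_left[of r1 T "N * \<Lambda>" "min \<kappa> (e / 4)"] r1 N \<Lambda> \<kappa> e by auto
  have r3e: "\<Lambda> * (T - r3) < e / 4"
  proof -
    have "1 * (\<Lambda> * (T - r3)) \<le> N * (\<Lambda> * (T - r3))"
      by (rule mult_right_mono[OF N]) (use \<Lambda> r3 in auto)
    then show ?thesis using r3(3) by simp
  qed
  define \<eta> where "\<eta> = min (min (\<delta> / 2) (e / 4)) (\<kappa> / N)"
  have \<eta>: "\<eta> > 0" "\<eta> \<le> \<delta> / 2" "\<eta> \<le> e / 4" "N * \<eta> \<le> \<kappa>"
  proof -
    show "\<eta> > 0" using \<delta> e \<kappa> N by (simp add: \<eta>_def)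
    show "\<eta> \<le> \<delta> / 2" unfolding \<eta>_def by (rule min.coboundedI1, rule min.cobounded1)
    show "\<eta> \<le> e / 4" unfolding \<eta>_def by (rule min.coboundedI1, rule min.cobounded2)
    have "N * \<eta> \<le> N * (\<kappa> / N)" by (rule mult_left_mono) (use N in \<open>auto simp: \<eta>_def\<close>)
    then show "N * \<eta> \<le> \<kappa>" using N by simp
  qed
  obtain d where d: "d > 0"
    and appr: "\<And>b S v. b \<in> start \<Longrightarrow> norm (b - a) < d \<Longrightarrow> maximal b S v \<Longrightarrow>
      r3 < S \<and> (\<forall>s\<in>{0..r3}. norm (v s - u s) < \<eta>)"
    using maximal_approx[OF a u _ r3(2) \<eta>(1)] r1 r3 by auto
  show ?thesis
  proof (intro exI[of _ d] conjI ballI allI impI d)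
    fix b S v assume b: "b \<in> start" "norm (b - a) < d" and v: "maximal b S v"
    have r3S: "r3 < S" and vu: "\<And>s. 0 \<le> s \<Longrightarrow> s \<le> r3 \<Longrightarrow> norm (v s - u s) < \<eta>"
      using appr[OF b v] by auto
    have wvu: "\<bar>w (v s) - w (u s)\<bar> \<le> \<kappa>" if "0 \<le> s" "s \<le> r3" for s
    proof -
      have "N * norm (v s - u s) \<le> N * \<eta>" using vu[OF that] N by (intro mult_left_mono) auto
      then show ?thesis using w_diff[of "v s" "u s"] \<eta>(4) by linarith
    qed
    have r3p: "norm (v r3 - p) < e / 2"
    proof -
      have "norm (v r3 - p) \<le> norm (v r3 - u r3) + norm (u r3 - p)" by (rule tri)
      then show ?thesis using vu[of r3] up[of r3] \<eta>(3) r1 r3 r3e by simp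
    qed
    have "S \<le> r3 + \<tau>"
    proof (rule ccontr)
      assume "\<not> S \<le> r3 + \<tau>"
      define Q where "Q = r3 + \<tau>"
      have Q: "r3 < Q" "Q < S" "Q \<le> R"
        using \<open>\<not> S \<le> r3 + \<tau>\<close> \<tau> r3 by (auto simp: Q_def R_def)
      have solv: "sol b Q v" using sol_subinterval[OF maximalD(2)[OF v]] Q by simp
      define g where "g = (\<lambda>t. w (f (v t)))"
      have near: "norm (v t - p) < \<delta>" if "r1 \<le> t" "t \<le> Q" for t
      proof (cases "t \<le> r3")
        case True
        have "\<Lambda> * (T - t) \<le> \<Lambda> * (T - r1)" using that \<Lambda> by simp
        moreover have "norm (v t - p) \<le> norm (v t - u t) + norm (u t - p)" by (rule tri)
        ultimately show ?thesis using vu[of t] up[of t] \<eta>(2) that True r1 r3 by simp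
      next
        case False
        have "norm (v t - v r3) \<le> \<Lambda> * \<bar>t - r3\<bar>"
          by (rule lip[OF b(1) solv Q(3)]) (use False that r1 r3 in auto)
        also have "\<dots> \<le> \<Lambda> * \<tau>" using False that \<Lambda> by (intro mult_left_mono) (auto simp: Q_def)
        finally have "norm (v t - v r3) \<le> e / 4" using \<tau>(3) by simp
        moreover have "norm (v t - p) \<le> norm (v t - v r3) + norm (v r3 - p)" by (rule tri)
        ultimately have "norm (v t - p) < e" using r3p e by simp
        then show ?thesis by (simp add: e_def)
      qed
      have "continuous_on {0..Q} g"
        unfolding g_def w_def by (intro continuous_intros solD(4)[OF solv])
      moreover have "g t \<ge> 0" if "t \<in> {r1..Q}" for t
        unfolding g_def w_def I_def
        by (rule bdry[OF solD(2)[OF solv] near]) (use that r1 in auto)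
      moreover have pot: "radial_potential n g t = w b - w (v t)" if "t \<in> {0..Q}" for t
        using sol_linear[OF solv that w_lin] by (simp add: g_def)
      \<comment> \<open>The difference equals \<open>w (v r1) - w (v r3)\<close>, which is at least
        (w1 - \<kappa>) - 2 \<kappa>, and \<kappa> is at most \<open>w1 / 4\<close>.\<close>
      moreover have "radial_potential n g r3 - radial_potential n g r1 \<ge> w1 / 4"
      proof -
        have "w (u r3) \<le> \<kappa>"
        proof -
          have "w (u r3) \<le> N * norm (u r3 - p)" using w_diff[of "u r3" p] wp by simp
          also have "\<dots> \<le> N * (\<Lambda> * (T - r3))" using up[of r3] r1 r3 N by (intro mult_left_mono) auto
          also have "\<dots> \<le> \<kappa>" using r3(3) by simp
          finally show ?thesis .
        qed
        then show ?thesis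
          using pot[of r3] pot[of r1] wvu[of r1] wvu[of r3] r1 r3 Q \<kappa>(2) unfolding w1_def[symmetric]
          by (simp add: abs_le_iff)
      qed
      ultimately have growth: "radial_potential n g Q - radial_potential n g r3
          \<ge> w1 / 4 / (r3 - r1) * (r1 / Q) ^ (n - 1) * (Q - r3)"
        using r1 r3 Q w1 n_pos by (intro radial_potential_growth) auto
      have "c \<le> w1 / 4 / (r3 - r1) * (r1 / Q) ^ (n - 1)"
        unfolding c_def using r1 r3 Q w1 T
        by (intro mult_mono divide_left_mono power_mono) auto
      then have "c * (Q - r3) \<le> w1 / 4 / (r3 - r1) * (r1 / Q) ^ (n - 1) * (Q - r3)"
        by (rule mult_right_mono) (use Q in simp)
      moreover have "Q - r3 = \<tau>" by (simp add: Q_def)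
      ultimately have "c * \<tau> \<le> w (v r3) - w (v Q)"
        using growth pot[of r3] pot[of Q] r1 r3 Q by simp
      moreover have "w (v r3) < 2 * \<kappa>"
      proof -
        have "w (u r3) \<le> N * norm (u r3 - p)" using w_diff[of "u r3" p] wp by simp
        also have "\<dots> \<le> N * (\<Lambda> * (T - r3))" using up[of r3] r1 r3 N by (intro mult_left_mono) auto
        also have "\<dots> < \<kappa>" using r3(3) by simp
        finally show ?thesis using wvu[of r3] r1 r3 by (simp add: abs_le_iff)
      qed
      moreover have "w (v Q) \<ge> 0"
        unfolding w_def using closure_component_nonneg[OF solD(2)[OF solv, of Q]] r1 r3 Q
        by (intro sum_nonneg) auto
      ultimately show False using \<kappa>(3) by linarith
    qed
    then have SR: "S \<le> R" using r3 \<tau> by (simp add: R_def)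
    have "norm (v S - v r3) \<le> \<Lambda> * \<bar>S - r3\<bar>"
      by (rule lip[OF b(1) maximalD(2)[OF v] SR]) (use r1 r3 r3S in auto)
    also have "\<dots> \<le> \<Lambda> * \<tau>" using \<Lambda> r3S \<open>S \<le> r3 + \<tau>\<close> by (intro mult_left_mono) auto
    finally have "norm (v S - v r3) \<le> e / 4" using \<tau>(3) by simp
    moreover have "norm (v S - p) \<le> norm (v S - v r3) + norm (v r3 - p)" by (rule tri)
    ultimately have "norm (v S - p) < e" using r3p e by simp
    then show "norm (v S - u T) < \<epsilon>" by (simp add: e_def p_def)
  qed
qed

text \<open>Near a boundary point the components with positive limit move at most as far as the
  sum of the others decreases, and that sum is small from the start.\<close>

lemma target_continuous_boundary:
  assumes a: "a \<in> frontier pos_orthant" "a \<noteq> 0" and \<epsilon>: "\<epsilon> > 0"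
  shows "\<exists>d>0. \<forall>b\<in>start. \<forall>S v. norm (b - a) < d \<longrightarrow> maximal b S v \<longrightarrow> norm (v S - a) < \<epsilon>"
proof -
  obtain \<delta> C where \<delta>: "\<delta> > 0" and C: "C > 0"
    and b1: "\<And>v. v \<in> closure pos_orthant \<Longrightarrow> norm (v - a) < \<delta> \<Longrightarrow> 0 \<le> (\<Sum>i | a $ i = 0. f v $ i)"
    and b2: "\<And>v j. v \<in> closure pos_orthant \<Longrightarrow> norm (v - a) < \<delta> \<Longrightarrow> a $ j > 0 \<Longrightarrow>
      \<bar>f v $ j\<bar> \<le> C * (\<Sum>i | a $ i = 0. f v $ i)"
    using f_bdry_closure[OF a] by metis
  define I where "I = {i. a $ i = 0}"
  define w where "w = (\<lambda>v :: real ^ 'l. \<Sum>i\<in>I. v $ i)"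
  define N where "N = real CARD('l)"
  have N: "N \<ge> 1" by (simp add: N_def)
  have w_lin: "bounded_linear w" unfolding w_def by (rule bounded_linear_sum_components)
  have wa: "w a = 0" by (simp add: w_def I_def)
  define e where "e = min \<epsilon> \<delta> / 2"
  have e: "e > 0" "e < \<epsilon>" "e < \<delta>" using \<epsilon> \<delta> by (auto simp: e_def)
  \<comment> \<open>M bounds the displacement of a single component relative to
    \<open>norm (b - a)\<close>: 1 for the initial distance, C N for the drift of a component
    positive at a, and N for a component vanishing there. Summing over the N components explains d =
    e / (N M).\<close>
  define M where "M = 1 + (C + 1) * N"
  have M: "M \<ge> 1" using C N by (simp add: M_def)
  define d where "d = e / (N * M)"
  have d: "d > 0" using e N M by (simp add: d_def)
  have NMd: "N * (M * d) = e" using N M by (simp add: d_def)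
  show ?thesis
  proof (intro exI[of _ d] conjI ballI allI impI d)
    fix b S v assume b: "b \<in> start" "norm (b - a) < d" and v: "maximal b S v"
    have S: "S > 0" and solv: "sol b S v" using maximalD[OF v] by auto
    have wb: "w b \<le> N * norm (b - a)"
      using abs_sum_components_diff_le[where v=b and w=a and I=I] wa by (simp add: w_def N_def)
    \<comment> \<open>A bootstrap: as long as the path has stayed within distance e of a, it is
      strictly closer than e. A first time at distance exactly e is therefore impossible.\<close>
    have bound: "norm (v t - a) < e"
      if t: "t \<in> {0..S}" and near: "\<And>x. x \<in> {0..t} \<Longrightarrow> norm (v x - a) \<le> e" for t
    proof -
      have solt: "sol b t v" using sol_subinterval[OF solv] t by simp
      have fv: "continuous_on {0..t} (\<lambda>x. f (v x))" by (rule solD(4)[OF solt])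
      have wf: "continuous_on {0..t} (\<lambda>x. w (f (v x)))"
        unfolding w_def by (intro continuous_intros fv)
      have cl: "v x \<in> closure pos_orthant" "norm (v x - a) < \<delta>" if "x \<in> {0..t}" for x
        using solD(2)[OF solt that] near[OF that] e by auto
      have wv: "w (v t) = w b - radial_potential n (\<lambda>x. w (f (v x))) t"
        using sol_linear[OF solt _ w_lin, of t] t by simp
      have "radial_potential n (\<lambda>x. w (f (v x))) t \<ge> 0"
        by (rule radial_potential_nonneg[OF wf]) (use b1[OF cl] in \<open>simp add: w_def I_def\<close>)
      then have wvb: "w (v t) \<le> w b" using wv by simp
      have wv0: "w (v t) \<ge> 0"
        unfolding w_def using closure_component_nonneg[OF cl(1)[of t]] t by (intro sum_nonneg) auto
      have comp: "\<bar>(v t - a) $ i\<bar> \<le> M * norm (b - a)" for i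
      proof (cases "a $ i = 0")
        case True
        have "v t $ i \<le> w (v t)"
          unfolding w_def using True closure_component_nonneg[OF cl(1)[of t]] t
          by (intro member_le_sum) (auto simp: I_def)
        also have "\<dots> \<le> N * norm (b - a)" using wvb wb by simp
        also have "\<dots> \<le> M * norm (b - a)"
          using C N by (intro mult_right_mono) (auto simp: M_def distrib_right)
        finally show ?thesis using True closure_component_nonneg[OF cl(1)[of t], of i] t by simp
      next
        case False
        then have ai: "a $ i > 0" using a(1) by (auto simp: frontier_pos_orthant less_le)
        have fi: "continuous_on {0..t} (\<lambda>x. f (v x) $ i)" by (intro continuous_intros fv)
        have Cw: "continuous_on {0..t} (\<lambda>x. C * w (f (v x)))"
          and Cw': "continuous_on {0..t} (\<lambda>x. - C * w (f (v x)))" by (intro continuous_intros wf)+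
        have scale: "radial_potential n (\<lambda>x. k * w (f (v x))) t = k * (w b - w (v t))" for k
          using radial_potential_linear[OF bounded_linear_mult_right wf, of n k] wv by simp
        have fb: "\<bar>f (v x) $ i\<bar> \<le> C * w (f (v x))" if "x \<in> {0..t}" for x
          using b2[OF cl[OF that] ai] by (simp add: w_def I_def)
        have "radial_potential n (\<lambda>x. f (v x) $ i) t \<le> C * (w b - w (v t))"
          using radial_potential_mono[OF fi Cw, of n] fb scale[of C] by (simp add: abs_le_iff)
        moreover have "radial_potential n (\<lambda>x. f (v x) $ i) t \<ge> - C * (w b - w (v t))"
          using radial_potential_mono[OF Cw' fi, of n] fb scale[of "- C"] by (force simp: abs_le_iff)
        moreover have "C * (w b - w (v t)) \<le> C * (N * norm (b - a))"
          using wb wv0 C by (intro mult_left_mono) auto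
        ultimately have "\<bar>v t $ i - b $ i\<bar> \<le> C * (N * norm (b - a))"
          using sol_linear[OF solt _ bounded_linear_vec_nth[of i], of t] t by (simp add: abs_le_iff)
        moreover have "\<bar>b $ i - a $ i\<bar> \<le> norm (b - a)"
          using component_le_norm_cart[of "b - a" i] by simp
        moreover have "M * norm (b - a) = norm (b - a) + C * (N * norm (b - a)) + N * norm (b - a)"
          by (simp add: M_def algebra_simps)
        moreover have "N * norm (b - a) \<ge> 0" using N by simp
        ultimately show ?thesis by (simp add: abs_le_iff)
      qed
      have "norm (v t - a) \<le> (\<Sum>i\<in>UNIV. \<bar>(v t - a) $ i\<bar>)" by (rule norm_le_l1_cart)
      also have "\<dots> \<le> N * (M * norm (b - a))"
        using sum_bounded_above[of UNIV "\<lambda>i. \<bar>(v t - a) $ i\<bar>" "M * norm (b - a)"] comp by (simp add: N_def)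
      also have "\<dots> < N * (M * d)" using b(2) N M by simp
      finally show ?thesis using NMd by simp
    qed
    have "norm (v S - a) < e"
    proof (rule ccontr)
      assume neg: "\<not> ?thesis"
      define h where "h = (\<lambda>x. norm (v x - a))"
      have "continuous_on {0..S} h" unfolding h_def by (intro continuous_intros solD(1)[OF solv])
      moreover have "h 0 < e"
      proof -
        have "d * 1 \<le> d * (N * M)"
          using d mult_mono[OF N M] N by (intro mult_left_mono) auto
        then show ?thesis using NMd b(2) sol_0[OF solv] S by (simp add: h_def mult_ac)
      qed
      moreover have "h S \<ge> e" using neg by (simp add: h_def)
      ultimately obtain t where t: "t \<in> {0..S}" "h t = e" "\<And>x. x \<in> {0..t} \<Longrightarrow> h x \<le> e"
        using first_crossing[of S h e S] S by auto
      then show False using bound[of t] by (auto simp: h_def)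
    qed
    then show "norm (v S - a) < \<epsilon>" using e by simp
  qed
qed

end

section \<open>The target map has a zero\<close>

text \<open>If \<open>\<psi>\<close> had no zero, its radial projection \<open>P\<close> would retract the simplex onto its boundary.
  Reflecting \<open>y = P x\<close> to the multiple of \<open>max y - y\<close> in the simplex gives a map whose image lies in
  the boundary and which moves every boundary point, against Brouwer's theorem.\<close>

lemma simplex_map_has_zero:
  fixes \<psi> :: "real ^ 'l \<Rightarrow> real ^ 'l"
  defines "\<Delta> \<equiv> {x :: real ^ 'l. (\<forall>i. x $ i \<ge> 0) \<and> (\<Sum>i\<in>UNIV. x $ i) = 1}"
  assumes cont: "continuous_on \<Delta> \<psi>"
    and nonneg: "\<And>x i. x \<in> \<Delta> \<Longrightarrow> \<psi> x $ i \<ge> 0"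
    and bdry: "\<And>x. x \<in> \<Delta> \<Longrightarrow> \<exists>i. \<psi> x $ i = 0"
    and id: "\<And>x i. x \<in> \<Delta> \<Longrightarrow> x $ i = 0 \<Longrightarrow> \<psi> x = x"
  shows "\<exists>x\<in>\<Delta>. \<psi> x = 0"
proof (rule ccontr)
  assume "\<not> ?thesis"
  then have nz: "\<psi> x \<noteq> 0" if "x \<in> \<Delta>" for x using that by blast
  define \<sigma> where "\<sigma> = (\<lambda>x. \<Sum>i\<in>UNIV. \<psi> x $ i)"
  have \<sigma>: "\<sigma> x > 0" if x: "x \<in> \<Delta>" for x
  proof -
    have "\<exists>i. \<psi> x $ i \<noteq> 0" using nz[OF x] by (simp add: vec_eq_iff)
    then obtain i where "\<psi> x $ i > 0" using nonneg[OF x] by (metis less_le)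
    then show ?thesis
      unfolding \<sigma>_def using nonneg[OF x] by (intro sum_pos2[of _ i]) auto
  qed
  define P where "P = (\<lambda>x. (1 / \<sigma> x) *\<^sub>R \<psi> x)"
  have P_nonneg: "P x $ i \<ge> 0" if "x \<in> \<Delta>" for x i
    using nonneg[OF that] \<sigma>[OF that] by (simp add: P_def)
  have P_sum: "(\<Sum>i\<in>UNIV. P x $ i) = 1" if "x \<in> \<Delta>" for x
    using \<sigma>[OF that] by (simp add: P_def \<sigma>_def flip: sum_divide_distrib)
  have P_zero: "\<exists>i. P x $ i = 0" if "x \<in> \<Delta>" for x
    using bdry[OF that] by (auto simp: P_def)
  define N where "N = real CARD('l)"
  \<comment> \<open>On \<Delta> the components of \<open>P x\<close> are nonnegative, so this is the
    largest of them, in a form whose continuity is immediate.\<close>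
  define M where "M = (\<lambda>x. infnorm (P x))"
  have PM: "P x $ i \<le> M x" for x i
    using component_le_infnorm_cart[of "P x" i] by (simp add: M_def)
  have M_attained: "\<exists>i. P x $ i = M x" if "x \<in> \<Delta>" for x
  proof -
    have "M x \<in> (\<lambda>i. \<bar>P x \<bullet> i\<bar>) ` Basis"
      unfolding M_def infnorm_Max by (rule Max_in) auto
    then obtain i where "M x = \<bar>P x $ i\<bar>"
      by (auto simp: Basis_vec_def inner_axis)
    then show ?thesis using P_nonneg[OF that, of i] by auto
  qed
  have M_pos: "M x > 0" if x: "x \<in> \<Delta>" for x
  proof (rule ccontr)
    assume "\<not> M x > 0"
    then have "(\<Sum>i\<in>UNIV. P x $ i) \<le> 0" using PM[of x] by (intro sum_nonpos) (force intro: order_trans)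
    then show False using P_sum[OF x] by simp
  qed
  have NM: "N * M x > 1" if x: "x \<in> \<Delta>" for x
  proof -
    obtain j where j: "P x $ j = 0" using P_zero[OF x] by blast
    have "1 = (\<Sum>i\<in>UNIV. P x $ i)" using P_sum[OF x] by simp
    also have "\<dots> < (\<Sum>i\<in>(UNIV :: 'l set). M x)"
      by (rule sum_strict_mono_ex1) (use PM M_pos[OF x] j in \<open>auto intro!: exI[of _ j]\<close>)
    finally show ?thesis by (simp add: N_def)
  qed
  \<comment> \<open>The divisor is the sum of the components of
    \<open>M x *\<^sub>R 1 - P x\<close>. It is positive because the components of
    \<open>P x\<close> are at most \<open>M x\<close>, sum to 1, and one of them is 0.\<close>
  define \<Phi> where "\<Phi> = (\<lambda>x. (1 / (N * M x - 1)) *\<^sub>R (M x *\<^sub>R 1 - P x))"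
  have contP: "continuous_on \<Delta> P"
    unfolding P_def \<sigma>_def
    by (intro continuous_intros cont) (use \<sigma> in \<open>force simp: \<sigma>_def\<close>)
  then have "continuous_on \<Delta> \<Phi>"
    unfolding \<Phi>_def M_def
  proof (intro continuous_intros ballI)
    show "N * infnorm (P x) - 1 \<noteq> 0" if "x \<in> \<Delta>" for x
      using NM[OF that] by (simp add: M_def)
  qed
  moreover have "\<Phi> \<in> \<Delta> \<rightarrow> \<Delta>"
  proof
    fix x assume x: "x \<in> \<Delta>"
    have "(\<Sum>i\<in>UNIV. \<Phi> x $ i) = (N * M x - (\<Sum>i\<in>UNIV. P x $ i)) / (N * M x - 1)"
      by (simp add: \<Phi>_def sum_subtractf N_def flip: sum_divide_distrib)
    also have "\<dots> = 1" using NM[OF x] P_sum[OF x] by simp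
    finally show "\<Phi> x \<in> \<Delta>"
      using NM[OF x] PM[of x] by (auto simp: \<Delta>_def \<Phi>_def)
  qed
  moreover have "compact \<Delta>"
  proof -
    have "\<Delta> = cbox 0 1 \<inter> {x. (\<Sum>i\<in>UNIV. x $ i) = 1}"
    proof -
      have "x $ i \<le> 1" if "\<And>i. x $ i \<ge> 0" "(\<Sum>i\<in>UNIV. x $ i) = 1" for x :: "real ^ 'l" and i
        using member_le_sum[of i UNIV "\<lambda>i. x $ i"] that by simp
      then show ?thesis by (auto simp: \<Delta>_def mem_box_cart)
    qed
    moreover have "closed {x :: real ^ 'l. (\<Sum>i\<in>UNIV. x $ i) = 1}"
      by (intro closed_Collect_eq continuous_intros)
    ultimately show ?thesis by (simp add: compact_Int_closed)
  qed
  moreover have "convex \<Delta>"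
    by (rule convexI) (auto simp: \<Delta>_def sum.distrib simp flip: sum_distrib_left)
  moreover have "\<Delta> \<noteq> {}"
  proof -
    have "(1 / N) *\<^sub>R (1 :: real ^ 'l) \<in> \<Delta>" by (simp add: \<Delta>_def N_def)
    then show ?thesis by blast
  qed
  ultimately obtain x where x: "x \<in> \<Delta>" "\<Phi> x = x"
    using brouwer[of \<Delta> \<Phi>] by metis
  \<comment> \<open>At an index where \<open>P x\<close> is maximal the reflection is 0, so the
    fixed point x lies on the boundary. There P fixes x, and the same component would be both the
    positive maximum and 0.\<close>
  obtain i where i: "P x $ i = M x" using M_attained[OF x(1)] by blast
  have "x $ i = \<Phi> x $ i" using x(2) by simp
  also have "\<dots> = 0" by (simp add: \<Phi>_def i)
  finally have xi: "x $ i = 0" .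
  have "\<psi> x = x" by (rule id[OF x(1) xi])
  moreover have "\<sigma> x = 1" using x(1) calculation by (simp add: \<sigma>_def \<Delta>_def)
  ultimately have "P x = x" by (simp add: P_def)
  then show False using i xi M_pos[OF x(1)] by simp
qed

context shooting
begin

lemma global_or_target_0:
  "(\<exists>a\<in>start. \<exists>u. \<forall>T\<ge>0. sol a T u \<and> u T \<in> pos_orthant) \<or> (\<exists>a\<in>start. \<exists>T u. maximal a T u \<and> u T = 0)"
proof (rule ccontr)
  assume neg: "\<not> ?thesis"
  then have "\<forall>a\<in>start. \<exists>T u. maximal a T u" using global_or_maximal by blast
  \<comment> \<open>Exit times and solutions are picked by choice. The continuity lemmas quantify
    over all maximal solutions and hence apply to any selection.\<close>
  then obtain \<tau> \<upsilon> where m: "\<And>a. a \<in> start \<Longrightarrow> maximal a (\<tau> a) (\<upsilon> a)" by metis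
  have nz: "\<upsilon> a (\<tau> a) \<noteq> 0" if "a \<in> start" for a using neg m[OF that] that by blast
  define \<psi> where "\<psi> = (\<lambda>a. if a \<in> pos_orthant then \<upsilon> a (\<tau> a) else a)"
  define \<Delta> where "\<Delta> = {x :: real ^ 'l. (\<forall>i. x $ i \<ge> 0) \<and> (\<Sum>i\<in>UNIV. x $ i) = 1}"
  have \<Delta>_pos: "x \<in> start" if "x \<in> \<Delta>" "x \<in> pos_orthant" for x
    using that by (simp add: start_def \<Delta>_def)
  have \<Delta>_bdry: "x \<in> frontier pos_orthant" if "x \<in> \<Delta>" "x \<notin> pos_orthant" for x
    unfolding frontier_pos_orthant using that
    by (auto simp: \<Delta>_def pos_orthant_def not_less intro: antisym)
  have \<Delta>_nz: "x \<noteq> 0" if "x \<in> \<Delta>" for x using that by (auto simp: \<Delta>_def)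
  have \<psi>_frontier: "\<psi> x \<in> frontier pos_orthant" if "x \<in> \<Delta>" for x
    using maximalD(4)[OF m[OF \<Delta>_pos[OF that]]] \<Delta>_bdry[OF that] by (simp add: \<psi>_def)
  have "continuous_on \<Delta> \<psi>"
    unfolding continuous_on_iff
  proof (intro ballI allI impI)
    fix x and e :: real assume x: "x \<in> \<Delta>" and e: "e > 0"
    show "\<exists>d>0. \<forall>x'\<in>\<Delta>. dist x' x < d \<longrightarrow> dist (\<psi> x') (\<psi> x) < e"
    proof (cases "x \<in> pos_orthant")
      case True
      note xs = \<Delta>_pos[OF x True]
      obtain d where d: "d > 0" "\<And>b S v. b \<in> start \<Longrightarrow> norm (b - x) < d \<Longrightarrow> maximal b S v \<Longrightarrow>
          norm (v S - \<upsilon> x (\<tau> x)) < e"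
        using target_continuous_interior[OF xs m[OF xs] nz[OF xs] e] by blast
      obtain d' where d': "d' > 0" "ball x d' \<subseteq> pos_orthant"
        using open_pos_orthant True by (rule openE)
      have "dist (\<psi> x') (\<psi> x) < e" if "x' \<in> \<Delta>" "dist x' x < min d d'" for x'
      proof -
        have "x' \<in> pos_orthant" using d'(2) that(2) by (auto simp: dist_commute)
        then show ?thesis
          using d(2)[OF \<Delta>_pos[OF that(1)] _ m[OF \<Delta>_pos[OF that(1)]]] that True by (simp add: \<psi>_def dist_norm)
      qed
      then show ?thesis using d(1) d'(1) by (intro exI[of _ "min d d'"]) auto
    next
      case False
      obtain d where d: "d > 0" "\<And>b S v. b \<in> start \<Longrightarrow> norm (b - x) < d \<Longrightarrow> maximal b S v \<Longrightarrow>
          norm (v S - x) < e"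
        using target_continuous_boundary[OF \<Delta>_bdry[OF x False] \<Delta>_nz[OF x] e] by blast
      \<comment> \<open>A boundary point has neighbours of both kinds: d controls those in the
        orthant, and e those on the boundary, which \<psi> fixes.\<close>
      have "dist (\<psi> x') (\<psi> x) < e" if "x' \<in> \<Delta>" "dist x' x < min d e" for x'
        using d(2)[OF \<Delta>_pos[OF that(1)] _ m[OF \<Delta>_pos[OF that(1)]]] that False by (simp add: \<psi>_def dist_norm)
      then show ?thesis using d(1) e by (intro exI[of _ "min d e"]) auto
    qed
  qed
  moreover have "\<psi> x $ i \<ge> 0" "\<exists>i. \<psi> x $ i = 0" if "x \<in> \<Delta>" for x i
    using \<psi>_frontier[OF that] by (auto simp: frontier_pos_orthant)
  moreover have "\<psi> x = x" if "x $ i = 0" for x i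
  proof -
    have "x \<notin> pos_orthant" using that by (auto simp: pos_orthant_def intro!: exI[of _ i])
    then show ?thesis by (simp add: \<psi>_def)
  qed
  ultimately obtain x where "x \<in> \<Delta>" "\<psi> x = 0"
    using simplex_map_has_zero[of \<psi>, folded \<Delta>_def] by blast
  then show False using nz[OF \<Delta>_pos] \<Delta>_nz by (auto simp: \<psi>_def split: if_splits)
qed

text \<open>The regularity input for the Hoelder bounds: on a compact interval a globally positive
  solution stays in some \<open>box_from e\<close> with e > 0, so a Lipschitz function is composed
  with a Lipschitz path.\<close>

lemma global_sol_lipschitz:
  assumes a: "a \<in> start" and u: "\<And>T. T \<ge> 0 \<Longrightarrow> sol a T u" "\<And>T. T \<ge> 0 \<Longrightarrow> u T \<in> pos_orthant"
  shows "\<exists>L. L-lipschitz_on {0..R} (\<lambda>t. f (u t) $ i)"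
proof (cases "R \<ge> 0")
  case True
  obtain e where e: "e > 0" "\<And>s i. s \<in> {0..R} \<Longrightarrow> e < u s $ i"
    using path_in_pos_orthant_lower_bound[OF solD(1)[OF u(1)[OF True]] True] u(2) by auto
  obtain L where L: "L-lipschitz_on (box_from e) f" by (rule f_lipschitz_on_box[OF e(1)])
  obtain B where B: "B > 0" "\<And>v. v \<in> box_from 0 \<Longrightarrow> norm (f v) \<le> B" by (rule f_bounded_on_box) blast
  have L0: "L \<ge> 0" using L by (rule lipschitz_on_nonneg)
  have "(L * (B * R))-lipschitz_on {0..R} (\<lambda>t. f (u t) $ i)"
  proof (rule lipschitz_onI)
    fix x y assume xy: "x \<in> {0..R}" "y \<in> {0..R}"
    have box: "u s \<in> box_from e" if "s \<in> {0..R}" for s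
      using e(2)[OF that] sol_component_le_1[OF u(1)[OF True] that a] by (auto simp: mem_box_from less_imp_le)
    have "dist (f (u x) $ i) (f (u y) $ i) \<le> dist (f (u x)) (f (u y))" by (rule dist_vec_nth_le)
    also have "\<dots> \<le> L * dist (u x) (u y)" by (rule lipschitz_onD[OF L box[OF xy(1)] box[OF xy(2)]])
    also have "\<dots> \<le> L * (B * R * \<bar>x - y\<bar>)"
      unfolding dist_norm by (rule mult_left_mono[OF sol_lipschitz[OF a u(1)[OF True] B(2) xy] L0])
    finally show "dist (f (u x) $ i) (f (u y) $ i) \<le> L * (B * R) * dist x y" by (simp add: dist_real_def mult.assoc)
  qed (use L0 B True in auto)
  then show ?thesis by blast
qed (auto intro!: exI[of _ 0] lipschitz_onI)

lemma sol_component: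
  assumes "sol a T u" "r \<in> {0..T}"
  shows "u r $ i = a $ i - radial_potential n (\<lambda>t. f (u t) $ i) r"
  by (rule sol_linear[OF assms bounded_linear_vec_nth])

end

section \<open>From radial profiles to solutions on balls and on the whole space\<close>

theorem theorem1p1:
  fixes f :: "real ^ 'l \<Rightarrow> real ^ 'l"
  assumes f_cont: "continuous_on (closure pos_orthant) f"
    and f_lip: "locally_lipschitz_on pos_orthant f"
    and f_sum: "\<And>v. v \<in> pos_orthant \<Longrightarrow> (\<Sum>i\<in>UNIV. f v $ i) \<ge> 0"
    and f_bdry: "\<And>a :: real ^ 'l. a \<in> frontier pos_orthant \<Longrightarrow> a \<noteq> 0 \<Longrightarrow>
      \<exists>\<delta>>0. \<exists>C\<ge>0. \<forall>\<beta>\<in>pos_orthant. norm (\<beta> - a) < \<delta> \<longrightarrow>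
        (\<Sum>i | a $ i > 0. \<bar>f \<beta> $ i\<bar>) \<le> C * (\<Sum>i | a $ i = 0. f \<beta> $ i)"
    and no_dirichlet: "\<And>R. R > 0 \<Longrightarrow>
      \<not> (\<exists>u :: real ^ 'n \<Rightarrow> real ^ 'l. positive_dirichlet_solution f R u)"
  shows "\<exists>u :: real ^ 'n \<Rightarrow> real ^ 'l.
    positive_classical_solution f UNIV u \<and>
    radially_symmetric u \<and>
    (\<forall>\<gamma>. 0 < \<gamma> \<and> \<gamma> < 1 \<longrightarrow> (\<forall>i. C2_holder_on \<gamma> UNIV (\<lambda>x. u x $ i)))"
proof -
  interpret shooting f "DIM(real ^ 'n)"
    by unfold_locales (use f_cont f_lip f_sum f_bdry in auto)
  have no_target_0: False if max: "maximal a T u" and uT: "u T = 0" for a T u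
  proof -
    have T: "T > 0" and s: "sol a T u" and pos: "\<And>r. 0 \<le> r \<Longrightarrow> r < T \<Longrightarrow> u r \<in> pos_orthant"
      using maximalD[OF max] by auto
    \<comment> \<open>Freezing the argument after T makes g continuous on the half-line. The
      resulting U is of class C^2 on the whole space and agrees with the profile on the closed ball,
      which includes continuity up to the sphere.\<close>
    define g where "g = (\<lambda>i t. f (u (min t T)) $ i)"
    have g: "continuous_on {0..} (g i)" for i
    proof -
      have "continuous_on {0..} (\<lambda>t. f (u (min t T)))"
        by (rule continuous_on_compose2[OF solD(4)[OF s]]) (use T in \<open>auto intro!: continuous_intros\<close>)
      then show ?thesis unfolding g_def by (intro continuous_intros)
    qed
    define U where "U = (\<lambda>x :: real ^ 'n. \<chi> i. a $ i - radial_potential DIM(real ^ 'n) (g i) (norm x))"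
    have U_eq: "U x = u (norm x)" if "norm x \<le> T" for x
    proof -
      have "radial_potential DIM(real ^ 'n) (g i) (norm x) = radial_potential DIM(real ^ 'n) (\<lambda>t. f (u t) $ i) (norm x)" for i
        by (rule radial_potential_cong) (use that in \<open>simp add: g_def min_def\<close>)
      then show ?thesis using sol_component[OF s, of "norm x"] that by (simp add: U_def vec_eq_iff)
    qed
    have C2: "Ck_on 2 S (\<lambda>x. U x $ i)" for S i
      unfolding U_def vec_lambda_beta by (rule Ck_on_2_radial_function[OF g])
    have lap: "- laplacian (\<lambda>y. U y $ i) x = g i (norm x)" for i x
      unfolding U_def vec_lambda_beta by (simp only: laplacian_radial_function[OF g] minus_minus)
    have "positive_dirichlet_solution f T U"
      unfolding positive_dirichlet_solution_def positive_classical_solution_def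
    proof (intro conjI allI ballI C2)
      fix i x assume x: "x \<in> ball (0 :: real ^ 'n) T"
      show "- laplacian (\<lambda>y. U y $ i) x = f (U x) $ i"
        unfolding lap using x U_eq[of x] by (simp add: g_def)
      show "U x $ i > 0"
        using x U_eq[of x] pos[of "norm x"] by (simp add: pos_orthant_def)
    next
      have "continuous_on (closure (ball 0 T)) (\<lambda>x. U x $ i)" for i
        using C2[of "closure (ball 0 T)" i] by (simp add: numeral_2_eq_2)
      then show "continuous_on (closure (ball 0 T)) U"
        using continuous_on_vec_lambda[of "closure (ball 0 T)" "\<lambda>i x. U x $ i"] by simp
    next
      fix x i assume "x \<in> frontier (ball (0 :: real ^ 'n) T)"
      then have "norm x = T" using T by simp
      then show "U x $ i = 0" using U_eq[of x] uT by simp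
    qed
    then show False using no_dirichlet[OF T] by blast
  qed
  then obtain a u where a: "a \<in> start" and u: "\<And>T. T \<ge> 0 \<Longrightarrow> sol a T u" "\<And>T. T \<ge> 0 \<Longrightarrow> u T \<in> pos_orthant"
    using global_or_target_0 by blast
  define g where "g = (\<lambda>i t. f (u t) $ i)"
  have lip: "\<exists>L. L-lipschitz_on {0..R} (g i)" for R i
    unfolding g_def by (rule global_sol_lipschitz[OF a u])
  have g: "continuous_on {0..} (g i)" for i
  proof -
    have "continuous (at t within {0..}) (g i)" if "t \<in> {0..}" for t
    proof -
      have "continuous_on {0..t + 1} (g i)" using lip lipschitz_on_continuous_on by blast
      then have "continuous (at t within {0..t + 1}) (g i)"
        using that by (simp add: continuous_on_eq_continuous_within)
      moreover have "at t within {0..t + 1} = at t within {0..}"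
        by (rule at_within_nhd[of _ "{..<t + 1}"]) auto
      ultimately show ?thesis by simp
    qed
    then show ?thesis by (simp add: continuous_on_eq_continuous_within)
  qed
  define U where "U = (\<lambda>x :: real ^ 'n. \<chi> i. a $ i - radial_potential DIM(real ^ 'n) (g i) (norm x))"
  have U_eq: "U x = u (norm x)" for x
    using sol_component[OF u(1)[of "norm x"], of "norm x"] by (simp add: U_def g_def vec_eq_iff)
  have lap: "- laplacian (\<lambda>y. U y $ i) x = g i (norm x)" for i x
    unfolding U_def vec_lambda_beta by (simp only: laplacian_radial_function[OF g] minus_minus)
  show ?thesis
  proof (intro exI[of _ U] conjI allI impI)
    show "positive_classical_solution f UNIV U"
      unfolding positive_classical_solution_def
    proof (intro allI conjI ballI)
      show "Ck_on 2 UNIV (\<lambda>x. U x $ i)" for i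
        unfolding U_def vec_lambda_beta by (rule Ck_on_2_radial_function[OF g])
      show "- laplacian (\<lambda>y. U y $ i) x = f (U x) $ i" for i x
        unfolding lap by (simp add: U_eq g_def)
      show "U x $ i > 0" for i x
        using u(2)[of "norm x"] by (simp add: U_eq pos_orthant_def)
    qed
    show "radially_symmetric U" by (simp add: radially_symmetric_def U_eq)
    show "C2_holder_on \<gamma> UNIV (\<lambda>x. U x $ i)" if "0 < \<gamma> \<and> \<gamma> < 1" for \<gamma> i
      unfolding U_def vec_lambda_beta
      by (rule C2_holder_on_radial_function[OF g lip]) (use that in auto)
  qed
qed

end
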